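(* Let $n\ge 2$, let $\Omega\subset\mathbb{R}^n$ be a bounded convex domain, and let $u$ be the strictly convex solution (smooth in $\Omega$ and of class $C^2$ on $\overline{\Omega}$) of the Dirichlet problem $$\det D^2u=1\ \text{ in }\Omega,\qquad u=0\ \text{ on }\partial\Omega .$$ Then the function $$\psi=\sum_{k,l=1}^n\frac{\partial\sigma_2(D^2u)}{\partial u_{kl}}\,u_ku_l-2(n-1)u$$ attains its maximum (over $\overline{\Omega}$) on the boundary $\partial\Omega$. Moreover, $\psi$ attains its maximum at some point of the (open) domain $\Omega$ if and only if $\Omega$ is an ellipse (in the case $n=2$), respectively a ball (in the case $n\ge 3$).
   Context: Subscripts denote partial derivatives: $u_k=\partial u/\partial x_k$, $u_{kl}=\partial^2u/\partial x_k\partial x_l$, and $D^2u=(u_{kl})$ is the Hessian matrix. For a symmetric $n\times n$ matrix $W$ with eigenvalues $\lambda_1,\dots,\lambda_n$, $\sigma_2(W)=\sum_{1\le i<j\le n}\lambda_i\lambda_j$. The derivative $\partial\sigma_2(D^2u)/\partial u_{kl}$ is taken treating the $n^2$ matrix entries as independent variables, so it equals $\sum_{j\ne k}u_{jj}$ if $k=l$ and $-u_{kl}$ if $k\neq l$. "Strictly convex" means that the Hessian $D^2u$ is positive definite. "$\Omega$ is an ellipse" means that $\Omega$ is the open region bounded by an ellipse in $\mathbb{R}^2$ (discs included); a ball is an open Euclidean ball. *)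

theory Defs
  imports "HOL-Analysis.Analysis" "HOL-Computational_Algebra.Fundamental_Theorem_Algebra"
begin

section \<open>The second elementary symmetric function of the eigenvalues\<close>

text \<open>
  \<open>eigenvalue_family W lam\<close>: the numbers \<open>lam 0, \<dots>, lam (n - 1)\<close> are the eigenvalues of \<open>W\<close>,
  listed with algebraic multiplicity.  Nonsymmetric (hence complex) spectra are admitted because
  the derivative of \<open>\<sigma>\<^sub>2\<close> treats the \<open>n\<^sup>2\<close> matrix entries as independent variables, so \<open>\<sigma>\<^sub>2\<close> has
  to be defined off the symmetric matrices too.
\<close>

definition eigenvalue_family :: "real^'n^'n \<Rightarrow> (nat \<Rightarrow> complex) \<Rightarrow> bool" where
  "eigenvalue_family W lam \<longleftrightarrow>
     (\<forall>z. det (mat z - (\<chi> i j. complex_of_real (W $ i $ j))) = (\<Prod>i<CARD('n). z - lam i))"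

text \<open>The value is well defined and real: see \<open>sigma2_eigenvalues\<close> and \<open>sigma2_eq\<close> below.\<close>

definition sigma2 :: "real^'n^'n \<Rightarrow> real" where
  "sigma2 W = (THE s. \<exists>lam. eigenvalue_family W lam \<and>
                 complex_of_real s = (\<Sum>j<CARD('n). \<Sum>i<j. lam i * lam j))"

definition matrix_unit :: "'n \<Rightarrow> 'n \<Rightarrow> real^'n^'n" where
  "matrix_unit k l = (\<chi> i j. if i = k \<and> j = l then 1 else 0)"

text \<open>The partial derivative of \<open>\<sigma>\<^sub>2\<close> with respect to the \<open>(k, l)\<close> entry; its explicit form is
  \<open>dsigma2_symmetric\<close>.\<close>

definition dsigma2 :: "real^'n^'n \<Rightarrow> 'n \<Rightarrow> 'n \<Rightarrow> real" where
  "dsigma2 W k l = deriv (\<lambda>t. sigma2 (W + t *\<^sub>R matrix_unit k l)) 0"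


subsection \<open>Explicit formulas\<close>

lemma coeff_prod_linear:
  fixes f :: "'b \<Rightarrow> 'a::comm_ring_1"
  assumes "finite S"
  shows "coeff (\<Prod>i\<in>S. [:1, - f i:]) 0 = 1 \<and>
         coeff (\<Prod>i\<in>S. [:1, - f i:]) 1 = - (\<Sum>i\<in>S. f i) \<and>
         2 * coeff (\<Prod>i\<in>S. [:1, - f i:]) 2 = (\<Sum>i\<in>S. f i)\<^sup>2 - (\<Sum>i\<in>S. (f i)\<^sup>2)"
  using assms
proof (induction S rule: finite_induct)
  case empty
  then show ?case by simp
next
  case (insert x S)
  have c2: "coeff (pCons 0 q) 2 = coeff q 1" for q :: "'a poly"
    by (simp add: numeral_2_eq_2)
  show ?case
    using insert
    by (simp add: c2 algebra_simps power2_eq_square)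
qed

lemma sum_pairs_square:
  fixes f :: "nat \<Rightarrow> 'a::comm_ring_1"
  shows "2 * (\<Sum>j<n. \<Sum>i<j. f i * f j) = (\<Sum>i<n. f i)\<^sup>2 - (\<Sum>i<n. (f i)\<^sup>2)"
proof (induction n)
  case (Suc n)
  then show ?case
    by (simp add: algebra_simps power2_eq_square sum_distrib_left sum_distrib_right)
qed simp

text \<open>The polynomial matrix \<open>I - x A\<close>; the coefficient of \<open>x\<^sup>2\<close> in its determinant is \<open>\<sigma>\<^sub>2\<close>.\<close>

definition rev_char_matrix :: "complex^'n^'n \<Rightarrow> complex poly^'n^'n" where
  "rev_char_matrix A = (\<chi> i j. if i = j then [:1, - (A $ i $ j):] else [:0, - (A $ i $ j):])"

lemma poly_det:
  fixes M :: "'a::comm_ring_1 poly^'n^'n"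
  shows "poly (det M) x = det (\<chi> i j. poly (M $ i $ j) x)"
  by (simp add: det_def poly_sum poly_prod)

lemma coeff2_term:
  fixes A :: "complex^'n^'n"
  assumes "card {i. p i \<noteq> i} > 2"
  shows "coeff (\<Prod>i\<in>UNIV. rev_char_matrix A $ i $ p i) 2 = 0"
proof -
  let ?S = "{i. p i \<noteq> i}"
  have "[:0, 1:] ^ card ?S dvd (\<Prod>i\<in>?S. rev_char_matrix A $ i $ p i)"
  proof -
    have "(\<Prod>i\<in>?S. [:0, 1::complex:]) dvd (\<Prod>i\<in>?S. rev_char_matrix A $ i $ p i)"
    proof (rule prod_dvd_prod)
      fix i assume "i \<in> ?S"
      then have "rev_char_matrix A $ i $ p i = [:0,1:] * [: - (A $ i $ p i):]"
        by (auto simp: rev_char_matrix_def)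
      then show "[:0,1:] dvd rev_char_matrix A $ i $ p i"
        by (metis dvd_triv_left)
    qed
    then show ?thesis by simp
  qed
  also have "\<dots> dvd (\<Prod>i\<in>UNIV. rev_char_matrix A $ i $ p i)"
    by (rule prod_dvd_prod_subset) auto
  finally have "monom 1 (card ?S) dvd (\<Prod>i\<in>UNIV. rev_char_matrix A $ i $ p i)"
    by (simp add: monom_altdef)
  then show ?thesis
    using assms by (auto simp: monom_1_dvd_iff')
qed

lemma coeff2_transpose:
  fixes A :: "complex^'n^'n"
  assumes ab: "a \<noteq> b"
  shows "coeff (\<Prod>i\<in>UNIV. rev_char_matrix A $ i $ Transposition.transpose a b i) 2
           = A $ a $ b * A $ b $ a"
proof -
  let ?t = "Transposition.transpose a b"
  let ?f = "\<lambda>i. rev_char_matrix A $ i $ ?t i"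
  have "(\<Prod>i\<in>UNIV. ?f i) = ?f a * (\<Prod>i\<in>UNIV - {a}. ?f i)"
    by (rule prod.remove) auto
  also have "(\<Prod>i\<in>UNIV - {a}. ?f i) = ?f b * (\<Prod>i\<in>UNIV - {a} - {b}. ?f i)"
    using ab by (intro prod.remove) auto
  also have "(\<Prod>i\<in>UNIV - {a} - {b}. ?f i) = (\<Prod>i\<in>UNIV - {a} - {b}. [:1, - (A $ i $ i):])"
    by (intro prod.cong) (auto simp: rev_char_matrix_def)
  finally have *: "(\<Prod>i\<in>UNIV. ?f i) =
      [:0, - (A $ a $ b):] * ([:0, - (A $ b $ a):] * (\<Prod>i\<in>UNIV - {a} - {b}. [:1, - (A $ i $ i):]))"
    using ab by (simp add: rev_char_matrix_def)
  have "coeff (\<Prod>i\<in>UNIV - {a} - {b}. [:1, - (A $ i $ i):]) 0 = 1"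
    using coeff_prod_linear[of "UNIV - {a} - {b}" "\<lambda>i. A $ i $ i"] by simp
  then show ?thesis
    unfolding * by (simp add: numeral_2_eq_2)
qed

lemma permutes_two_moved:
  fixes p :: "'n::finite \<Rightarrow> 'n"
  assumes p: "p permutes UNIV" and "p \<noteq> id" and c: "card {i. p i \<noteq> i} \<le> 2"
  shows "\<exists>a b. a \<noteq> b \<and> p = Transposition.transpose a b"
proof -
  obtain a where a: "p a \<noteq> a" using \<open>p \<noteq> id\<close> by (auto simp: fun_eq_iff)
  have inj: "inj p" using p by (simp add: permutes_inj)
  then have pa: "p (p a) \<noteq> p a" using a by (auto dest: injD)
  have "{a, p a} = {i. p i \<noteq> i}"
    using a pa c by (intro card_seteq) auto
  then have "\<And>i. i \<noteq> a \<Longrightarrow> i \<noteq> p a \<Longrightarrow> p i = i" by auto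
  then have "p permutes {a, p a}"
    using p by (auto simp: permutes_def)
  then show ?thesis
    using a \<open>p \<noteq> id\<close> permutes_doubleton_iff by metis
qed

lemma coeff2_det:
  fixes A :: "complex^'n^'n"
  shows "2 * coeff (det (rev_char_matrix A)) 2 = (trace A)\<^sup>2 - trace (A ** A)"
proof -
  let ?M = "rev_char_matrix A"
  let ?g = "\<lambda>p. coeff (of_int (sign p) * (\<Prod>i\<in>UNIV. ?M $ i $ p i)) 2"
  let ?tr = "\<lambda>(a,b). Transposition.transpose a b :: 'n \<Rightarrow> 'n"
  obtain r :: "'n \<Rightarrow> nat" where r: "inj r"
    using finite_imp_inj_to_nat_seg[of "UNIV :: 'n set"] by auto
  define Q where "Q = {(a, b). r a < r b}"
  let ?T = "?tr ` Q"
  have sc: "coeff (of_int (sign p) * q) 2 = of_int (sign p) * coeff q 2" for p :: "'n \<Rightarrow> 'n" and q :: "complex poly"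
    by (auto simp: sign_def)
  have injT: "inj_on ?tr Q"
  proof (rule inj_onI, clarify)
    fix a b c d assume h: "(a,b) \<in> Q" "(c,d) \<in> Q"
      and e: "Transposition.transpose a b = Transposition.transpose c d"
    have "a \<noteq> b" "c \<noteq> d" using h by (auto simp: Q_def)
    then have "{a, b} = {c, d}"
      using e by (metis transpose_apply_first transpose_apply_other transpose_apply_second insert_commute)
    then show "a = c \<and> b = d"
      using h by (auto simp: Q_def doubleton_eq_iff)
  qed
  have idT: "id \<notin> ?T"
  proof
    assume "id \<in> ?T"
    then obtain a b where "(a, b) \<in> Q" "id = Transposition.transpose a b" by auto
    then show False
      by (metis Q_def case_prodD id_apply less_irrefl mem_Collect_eq transpose_apply_first)
  qed
  have "coeff (det ?M) 2 = (\<Sum>p | p permutes UNIV. ?g p)"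
    by (simp add: det_def coeff_sum)
  also have "\<dots> = sum ?g (insert id ?T)"
  proof (rule sum.mono_neutral_right)
    show "insert id ?T \<subseteq> {p. p permutes UNIV}"
      by (auto simp: permutes_id permutes_swap_id)
    show "\<forall>p\<in>{p. p permutes UNIV} - insert id ?T. ?g p = 0"
    proof
      fix p assume p: "p \<in> {p. p permutes UNIV} - insert id ?T"
      have "card {i. p i \<noteq> i} > 2"
      proof (rule ccontr)
        assume "\<not> ?thesis"
        then obtain a b where ab: "a \<noteq> b" "p = Transposition.transpose a b"
          using permutes_two_moved[of p] p by auto
        then have "r a < r b \<or> r b < r a" using r by (metis injD nat_neq_iff)
        then have "p \<in> ?T"
        proof
          assume "r a < r b" then show ?thesis using ab by (auto simp: Q_def image_iff)
        next
          assume "r b < r a"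
          then have "(b, a) \<in> Q" by (simp add: Q_def)
          moreover have "p = ?tr (b, a)" using ab by (simp add: transpose_commute)
          ultimately show ?thesis by blast
        qed
        then show False using p by simp
      qed
      then show "?g p = 0" by (simp add: sc coeff2_term)
    qed
  qed simp
  also have "\<dots> = ?g id + sum ?g ?T"
    using idT by (subst sum.insert) auto
  also have "sum ?g ?T = (\<Sum>q\<in>Q. ?g (?tr q))"
    by (simp add: sum.reindex[OF injT])
  also have "\<dots> = (\<Sum>(a,b)\<in>Q. - (A $ a $ b * A $ b $ a))"
  proof (rule sum.cong)
    fix q assume "q \<in> Q"
    then obtain a b where "q = (a, b)" "a \<noteq> b" by (cases q) (auto simp: Q_def)
    then show "?g (?tr q) = (case q of (a, b) \<Rightarrow> - (A $ a $ b * A $ b $ a))"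
      by (simp add: sc coeff2_transpose sign_swap_id)
  qed simp
  finally have 1: "coeff (det ?M) 2 = ?g id - (\<Sum>(a,b)\<in>Q. A $ a $ b * A $ b $ a)"
    by (simp add: sum_negf case_prod_unfold)
  have 2: "2 * ?g id = (trace A)\<^sup>2 - (\<Sum>i\<in>UNIV. (A $ i $ i)\<^sup>2)"
    using coeff_prod_linear[of UNIV "\<lambda>i. A $ i $ i"]
    by (simp add: sign_id rev_char_matrix_def trace_def)
  let ?h = "\<lambda>(a,b). A $ a $ b * A $ b $ a"
  have "trace (A ** A) = (\<Sum>q\<in>UNIV. ?h q)"
    by (simp add: trace_def matrix_matrix_mult_def sum.cartesian_product)
  also have "UNIV = range (\<lambda>i. (i, i)) \<union> (Q \<union> prod.swap ` Q)"
  proof -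
    have "(a, b) \<in> range (\<lambda>i. (i, i)) \<union> (Q \<union> prod.swap ` Q)" for a b
      using r by (cases "r a" "r b" rule: linorder_cases) (auto simp: Q_def image_iff dest: injD)
    then show ?thesis by (metis UNIV_eq_I surj_pair)
  qed
  also have "sum ?h \<dots> = sum ?h (range (\<lambda>i. (i, i))) + sum ?h (Q \<union> prod.swap ` Q)"
    by (rule sum.union_disjoint) (auto simp: Q_def)
  also have "sum ?h (Q \<union> prod.swap ` Q) = sum ?h Q + sum ?h (prod.swap ` Q)"
    by (rule sum.union_disjoint) (auto simp: Q_def)
  also have "sum ?h (prod.swap ` Q) = sum ?h Q"
    by (subst sum.reindex) (auto simp: case_prod_unfold mult.commute intro!: sum.cong inj_onI)
  also have "sum ?h (range (\<lambda>i. (i, i))) = (\<Sum>i\<in>UNIV. (A $ i $ i)\<^sup>2)"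
    by (subst sum.reindex) (auto simp: power2_eq_square inj_on_def)
  finally have 3: "trace (A ** A) = (\<Sum>i\<in>UNIV. (A $ i $ i)\<^sup>2) + 2 * sum ?h Q"
    by simp
  show ?thesis
    unfolding 1 3 right_diff_distrib 2 by simp
qed

lemma eigenvalue_family_sum:
  fixes W :: "real^'n^'n"
  assumes "eigenvalue_family W lam"
  shows "2 * (\<Sum>j<CARD('n). \<Sum>i<j. lam i * lam j)
           = complex_of_real ((trace W)\<^sup>2 - trace (W ** W))"
proof -
  let ?A = "(\<chi> i j. complex_of_real (W $ i $ j)) :: complex^'n^'n"
  let ?P = "det (rev_char_matrix ?A)" and ?R = "\<Prod>i<CARD('n). [:1, - lam i:]"
  have eq: "poly ?P x = poly ?R x" if "x \<noteq> 0" for x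
  proof -
    have "poly ?P x = det (\<chi> i. x *s (mat (1 / x) - ?A) $ i)"
      unfolding poly_det
      by (intro arg_cong[where f = det])
        (auto simp: vec_eq_iff rev_char_matrix_def mat_def that field_simps)
    also have "\<dots> = x ^ CARD('n) * det (mat (1 / x) - ?A)"
      using det_rows_mul[of "\<lambda>_. x" "\<lambda>i. (mat (1 / x) - ?A) $ i"]
      by (simp only: vec_lambda_eta prod_constant)
    also have "\<dots> = x ^ CARD('n) * (\<Prod>i<CARD('n). 1 / x - lam i)"
      using assms by (simp add: eigenvalue_family_def)
    also have "\<dots> = (\<Prod>i<CARD('n). x * (1 / x - lam i))"
      by (simp add: prod.distrib)
    also have "\<dots> = poly ?R x"
      using that by (simp add: poly_prod right_diff_distrib)
    finally show ?thesis .
  qed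
  have "?P = ?R"
  proof (rule ccontr)
    assume "?P \<noteq> ?R"
    then have "finite {x. poly (?P - ?R) x = 0}" 
      by (intro poly_roots_finite) simp
    moreover have "UNIV - {0} \<subseteq> {x. poly (?P - ?R) x = 0}" using eq by auto
    ultimately have "finite (UNIV - {0::complex})" by (rule rev_finite_subset)
    then show False by (simp add: infinite_UNIV_char_0)
  qed
  then have "(trace ?A)\<^sup>2 - trace (?A ** ?A) = 2 * coeff ?R 2"
    using coeff2_det[of ?A] by simp
  also have "\<dots> = 2 * (\<Sum>j<CARD('n). \<Sum>i<j. lam i * lam j)"
    using coeff_prod_linear[of "{..<CARD('n)}" lam] by (simp add: sum_pairs_square)
  finally show ?thesis
    by (simp add: trace_def matrix_matrix_mult_def)
qed

lemma eigenvalue_family_exists: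
  fixes W :: "real^'n^'n"
  shows "\<exists>lam. eigenvalue_family W lam"
proof -
  let ?A = "(\<chi> i j. complex_of_real (W $ i $ j)) :: complex^'n^'n"
  let ?N = "CARD('n)"
  define M :: "complex poly^'n^'n" where
    "M = (\<chi> i j. if i = j then [:- (?A $ i $ j), 1:] else [:- (?A $ i $ j):])"
  have pM: "poly (det M) z = det (mat z - ?A)" for z
    unfolding poly_det
    by (intro arg_cong[where f = det]) (auto simp: vec_eq_iff M_def mat_def)
  let ?g = "\<lambda>p. of_int (sign p) * (\<Prod>i\<in>UNIV. M $ i $ p i)"
  let ?D = "\<Prod>i\<in>UNIV. M $ i $ i"
  have D1: "degree ?D = ?N"
    by (simp add: M_def degree_prod_sum_eq)
  have D2: "lead_coeff ?D = 1"
    by (simp only: lead_coeff_prod) (simp add: M_def)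
  note D = D1 D2
  have dg: "degree (M $ i $ j) \<le> (if i = j then 1 else 0)" for i j
    by (simp add: M_def)
  have "degree (\<Sum>p\<in>{p. p permutes (UNIV :: 'n set)} - {id}. ?g p) < ?N"
  proof (rule degree_sum_less)
    fix p :: "'n \<Rightarrow> 'n"
    assume p: "p \<in> {p. p permutes UNIV} - {id}"
    then obtain a where a: "p a \<noteq> a" by (auto simp: fun_eq_iff)
    have "degree (?g p) \<le> degree (\<Prod>i\<in>UNIV. M $ i $ p i)"
      by (auto simp: sign_def)
    also have "\<dots> \<le> (\<Sum>i\<in>UNIV. degree (M $ i $ p i))"
      using degree_prod_sum_le[of UNIV "\<lambda>i. M $ i $ p i"] by (simp add: o_def)
    also have "\<dots> < (\<Sum>i\<in>(UNIV::'n set). 1)"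
    proof (rule sum_strict_mono_ex1)
      show "\<forall>i\<in>UNIV. degree (M $ i $ p i) \<le> 1"
      proof
        fix i
        show "degree (M $ i $ p i) \<le> 1"
          using dg[of i "p i"] by (auto split: if_splits)
      qed
      show "\<exists>i\<in>UNIV. degree (M $ i $ p i) < 1"
        using a dg[of a "p a"] by (intro bexI[of _ a]) auto
    qed simp
    finally show "degree (?g p) < ?N" by simp
  qed simp
  moreover have split: "det M = ?D + (\<Sum>p\<in>{p. p permutes UNIV} - {id}. ?g p)"
    unfolding det_def by (subst sum.remove[of _ id]) (auto simp: permutes_id sign_id)
  ultimately have deg: "degree (det M) = ?N" and lc: "lead_coeff (det M) = 1"
    using D by (simp_all add: degree_add_eq_left coeff_eq_0)
  obtain xs where xs: "mset xs = proots (det M)" using ex_mset by blast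
  have len: "length xs = ?N"
    using deg size_proots_complex[of "det M"] xs by (metis size_mset)
  have "det M = (\<Prod>x\<in>#mset xs. [:- x, 1:])"
    using complex_poly_decompose_multiset[of "det M"] lc xs by simp
  also have "\<dots> = prod_list (map (\<lambda>x. [:- x, 1:]) xs)"
    by (metis mset_map prod_mset_prod_list)
  also have "\<dots> = (\<Prod>i<?N. [:- (xs ! i), 1:])"
    by (simp add: prod.list_conv_set_nth len atLeast0LessThan)
  finally have "eigenvalue_family W (\<lambda>i. xs ! i)"
    unfolding eigenvalue_family_def pM[symmetric] by (simp add: poly_prod)
  then show ?thesis by blast
qed

lemma sigma2_eq:
  "sigma2 W = ((trace W)\<^sup>2 - trace (W ** W)) / 2"
proof -
  obtain lam where lam: "eigenvalue_family W lam"
    using eigenvalue_family_exists by blast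
  show ?thesis
    unfolding sigma2_def
  proof (rule the_equality)
    show "\<exists>lam. eigenvalue_family W lam \<and>
       complex_of_real (((trace W)\<^sup>2 - trace (W ** W)) / 2) = (\<Sum>j<CARD('a). \<Sum>i<j. lam i * lam j)"
      using lam eigenvalue_family_sum[OF lam] by (intro exI[of _ lam]) (simp add: field_simps)
  next
    fix s
    assume "\<exists>lam. eigenvalue_family W lam \<and>
       complex_of_real s = (\<Sum>j<CARD('a). \<Sum>i<j. lam i * lam j)"
    then have "complex_of_real (2 * s) = complex_of_real ((trace W)\<^sup>2 - trace (W ** W))"
      using eigenvalue_family_sum by fastforce
    then show "s = ((trace W)\<^sup>2 - trace (W ** W)) / 2"
      unfolding of_real_eq_iff by simp
  qed
qed

lemma sigma2_eigenvalues:
  fixes W :: "real^'n^'n"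
  assumes "eigenvalue_family W lam"
  shows "complex_of_real (sigma2 W) = (\<Sum>j<CARD('n). \<Sum>i<j. lam i * lam j)"
  using eigenvalue_family_sum[OF assms] by (simp add: sigma2_eq field_simps)

lemma dsigma2_eq:
  fixes W :: "real^'n^'n"
  shows "dsigma2 W k l = (if k = l then trace W else 0) - W $ l $ k"
proof -
  let ?E = "matrix_unit k l :: real^'n^'n"
  have tE: "trace ?E = (if k = l then 1 else 0)"
    by (auto simp: trace_def matrix_unit_def intro!: sum.neutral)
  have WE: "trace (W ** ?E) = W $ l $ k"
  proof -
    have "(\<Sum>j\<in>UNIV. W $ i $ j * ?E $ j $ i) = (if i = l then W $ l $ k else 0)" for i
      by (auto simp: matrix_unit_def if_distrib cong: if_cong)
    then show ?thesis by (simp add: trace_def matrix_matrix_mult_def)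
  qed
  have sq: "trace ((W + t *\<^sub>R ?E) ** (W + t *\<^sub>R ?E)) =
      trace (W ** W) + 2 * t * trace (W ** ?E) + t\<^sup>2 * trace (?E ** ?E)" for t
  proof -
    have "trace ((W + t *\<^sub>R ?E) ** (W + t *\<^sub>R ?E)) =
        trace (W ** W) + t * trace (W ** ?E) + t * trace (?E ** W) + t\<^sup>2 * trace (?E ** ?E)"
      by (simp add: trace_def matrix_matrix_mult_def algebra_simps sum.distrib
          sum_distrib_left power2_eq_square)
    then show ?thesis by (simp add: trace_mul_sym[of ?E W])
  qed
  have tr: "trace (W + t *\<^sub>R ?E) = trace W + t * trace ?E" for t
    by (simp add: trace_def sum.distrib sum_distrib_left)
  have "((\<lambda>t. sigma2 (W + t *\<^sub>R ?E)) has_field_derivative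
          trace W * trace ?E - trace (W ** ?E)) (at 0)"
    unfolding sigma2_eq sq tr by (auto intro!: derivative_eq_intros)
  then show ?thesis
    unfolding dsigma2_def by (simp add: DERIV_imp_deriv tE WE)
qed

lemma dsigma2_symmetric:
  fixes W :: "real^'n^'n"
  assumes "transpose W = W"
  shows "dsigma2 W k l = (if k = l then \<Sum>j\<in>UNIV - {k}. W $ j $ j else - W $ k $ l)"
proof -
  have "W $ l $ k = W $ k $ l"
    using assms by (metis transpose_def vec_lambda_beta)
  then show ?thesis
    by (simp add: dsigma2_eq trace_def sum_diff1)
qed


section \<open>Partial derivatives and regularity classes\<close>

definition partial :: "'n \<Rightarrow> (real^'n \<Rightarrow> real) \<Rightarrow> real^'n \<Rightarrow> real" where
  "partial k f x = deriv (\<lambda>t. f (x + t *\<^sub>R axis k 1)) 0"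

definition partials :: "'n list \<Rightarrow> (real^'n \<Rightarrow> real) \<Rightarrow> real^'n \<Rightarrow> real" where
  "partials ks f = foldr partial ks f"

text \<open>For open \<open>S\<close> this is the class \<open>C\<^sup>\<infinity>(S)\<close>: differentiability of a derivative of order \<open>m\<close>
  includes existence of those of order \<open>m + 1\<close> and continuity of that of order \<open>m\<close>.\<close>

definition smooth_on :: "(real^'n) set \<Rightarrow> (real^'n \<Rightarrow> real) \<Rightarrow> bool" where
  "smooth_on S f \<longleftrightarrow> (\<forall>ks. \<forall>x\<in>S. partials ks f differentiable (at x))"

text \<open>The class \<open>C\<^sup>2\<close> on the closure of an open set \<open>S\<close>: the partial derivatives of order at most
  two exist in \<open>S\<close> and extend continuously to the closure, the extension of \<open>f\<close> being \<open>f\<close> itself.\<close>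

definition C2_on_closure :: "(real^'n) set \<Rightarrow> (real^'n \<Rightarrow> real) \<Rightarrow> bool" where
  "C2_on_closure S f \<longleftrightarrow>
     (\<forall>ks. length ks < 2 \<longrightarrow>
        (\<forall>k. \<forall>x\<in>S. (\<lambda>t. partials ks f (x + t *\<^sub>R axis k 1)) differentiable (at 0))) \<and>
     continuous_on (closure S) f \<and>
     (\<forall>ks. length ks \<in> {1, 2} \<longrightarrow>
        (\<exists>g. continuous_on (closure S) g \<and> (\<forall>x\<in>S. g x = partials ks f x)))"

text \<open>Values on the boundary of the continuous extension.  They replace \<open>f x\<close> there because
  \<open>partial\<close> at a boundary point would depend on values of the function outside the closure.\<close>

definition closure_ext :: "(real^'n) set \<Rightarrow> (real^'n \<Rightarrow> real) \<Rightarrow> real^'n \<Rightarrow> real" where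
  "closure_ext S f x = (if x \<in> S then f x else Lim (at x within S) f)"

definition grad :: "(real^'n) set \<Rightarrow> (real^'n \<Rightarrow> real) \<Rightarrow> real^'n \<Rightarrow> real^'n" where
  "grad S u x = (\<chi> k. closure_ext S (partials [k] u) x)"

definition hessian :: "(real^'n) set \<Rightarrow> (real^'n \<Rightarrow> real) \<Rightarrow> real^'n \<Rightarrow> real^'n^'n" where
  "hessian S u x = (\<chi> k l. closure_ext S (partials [k, l] u) x)"

definition pos_def :: "real^'n^'n \<Rightarrow> bool" where
  "pos_def A \<longleftrightarrow> (\<forall>v. v \<noteq> 0 \<longrightarrow> v \<bullet> (A *v v) > 0)"


section \<open>The Dirichlet problem, the P-function and ellipses\<close>

definition strictly_convex_solution :: "(real^'n) set \<Rightarrow> (real^'n \<Rightarrow> real) \<Rightarrow> bool" where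
  "strictly_convex_solution \<Omega> u \<longleftrightarrow>
     smooth_on \<Omega> u \<and> C2_on_closure \<Omega> u \<and>
     (\<forall>x\<in>\<Omega>. pos_def (hessian \<Omega> u x)) \<and>
     (\<forall>x\<in>\<Omega>. det (hessian \<Omega> u x) = 1) \<and>
     (\<forall>x\<in>frontier \<Omega>. u x = 0)"

definition psi :: "(real^'n) set \<Rightarrow> (real^'n \<Rightarrow> real) \<Rightarrow> real^'n \<Rightarrow> real" where
  "psi \<Omega> u x =
     (\<Sum>k\<in>UNIV. \<Sum>l\<in>UNIV. dsigma2 (hessian \<Omega> u x) k l * grad \<Omega> u x $ k * grad \<Omega> u x $ l)
     - 2 * (real CARD('n) - 1) * u x"

text \<open>The open region bounded by an ellipse with centre \<open>c\<close>, semi-axes \<open>a\<close> and \<open>b\<close>, and principal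
  directions \<open>e\<close> and \<open>f\<close>.\<close>

definition is_ellipse :: "(real^'n) set \<Rightarrow> bool" where
  "is_ellipse E \<longleftrightarrow> CARD('n) = 2 \<and>
     (\<exists>c e f a b. norm e = 1 \<and> norm f = 1 \<and> e \<bullet> f = 0 \<and> a > 0 \<and> b > 0 \<and>
        E = {x. (((x - c) \<bullet> e) / a)\<^sup>2 + (((x - c) \<bullet> f) / b)\<^sup>2 < 1})"

end

theory Submission
  imports Defs
begin

text \<open>
  Let \<open>L = tr ((D\<^sup>2u)\<inverse> D\<^sup>2)\<close> be the linearisation of the equation \<open>det D\<^sup>2u = 1\<close> at \<open>u\<close>, and let
  \<open>T = \<Delta>u I - D\<^sup>2u\<close>, so that \<open>\<psi> = T\<^sub>k\<^sub>l u\<^sub>k u\<^sub>l - 2 (n - 1) u\<close>.  Because \<open>L u\<^sub>k = 0\<close>, because \<open>T\<close> is divergence free and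
  because \<open>L u = n\<close>, one finds
  \<open>L \<psi> = (\<bar>Du\<bar>\<^sup>2 tr Q - Q (Du, Du)) + (4 \<sigma>\<^sub>2 - 2 n (n - 1))\<close> with \<open>Q\<^sub>k\<^sub>l = L u\<^sub>k\<^sub>l\<close> (\<open>second_order_p_function\<close>).
  The matrix \<open>Q\<close> is positive semidefinite: for fixed \<open>x\<close> the function \<open>y \<mapsto> tr ((D\<^sup>2u x)\<inverse> D\<^sup>2u y)\<close> is at least \<open>n\<close> by
  the inequality between arithmetic and geometric means, with equality at \<open>y = x\<close>, and \<open>Q\<close> is its Hessian there
  (\<open>differentiated_equation\<close>).  So the first bracket is nonnegative, and the second one is nonnegative by Maclaurin's
  inequality.  Hence \<open>L \<psi> \<ge> 0\<close>, and the weak maximum principle puts the maximum on the boundary.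

  If the maximum is also attained inside, the strong maximum principle makes \<open>\<psi>\<close> constant.  For \<open>n \<ge> 3\<close> equality in
  Maclaurin's inequality gives \<open>D\<^sup>2u = I\<close>.  For \<open>n = 2\<close> Maclaurin's inequality is an identity; instead, the equation
  \<open>D\<psi> = 0\<close> together with the differentiated equation forces all third derivatives to vanish
  (\<open>planar_third_derivatives_zero\<close>).  In both cases \<open>u\<close> is a quadratic function and the domain is the set where it is
  negative (\<open>domain_if_quadratic\<close>), a ball or an ellipse.

  Conversely, over a ball or an ellipse the Dirichlet problem has an explicit quadratic solution, which is the only one
  by comparison (\<open>quadratic_if_domain\<close>), and for it \<open>\<psi>\<close> is constant.
\<close>

section \<open>Calculus of iterated partial derivatives\<close>

lemma partials_Cons: "partials (k # ks) f = partial k (partials ks f)"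
  by (simp add: partials_def)

lemma partials_snoc: "partials (ks @ [k]) f = partials ks (partial k f)"
  by (simp add: partials_def)

lemma partials_Nil: "partials [] f = f"
  by (simp add: partials_def)

lemma has_derivative_partials:
  fixes f :: "real^'n \<Rightarrow> real"
  assumes "f differentiable (at y)"
  shows "(f has_derivative (\<lambda>h. \<Sum>k\<in>UNIV. h $ k * partial k f y)) (at y)"
proof -
  obtain f' where f': "(f has_derivative f') (at y)"
    using assms by (auto simp: differentiable_def)
  then have lin: "linear f'" using has_derivative_linear by blast
  have p: "partial k f y = f' (axis k 1)" for k
  proof -
    have "((\<lambda>t. f (y + t *\<^sub>R axis k 1)) has_derivative (\<lambda>t. f' (t *\<^sub>R axis k 1))) (at 0)"
      by (rule has_derivative_compose[where g = f and f = "\<lambda>t. y + t *\<^sub>R axis k 1"])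
         (auto intro!: derivative_eq_intros simp: f')
    then have "((\<lambda>t. f (y + t *\<^sub>R axis k 1)) has_field_derivative f' (axis k 1)) (at 0)"
      by (simp add: has_field_derivative_def linear_scale[OF lin] mult.commute[of _ "f' _"])
    then show ?thesis by (simp add: partial_def DERIV_imp_deriv)
  qed
  have "f' h = (\<Sum>k\<in>UNIV. h $ k * partial k f y)" for h
  proof -
    have "f' h = f' (\<Sum>k\<in>UNIV. (h $ k) *\<^sub>R axis k 1)"
      by (metis (no_types, lifting) basis_expansion scalar_mult_eq_scaleR sum.cong)
    then show ?thesis by (simp add: linear_sum[OF lin] linear_scale[OF lin] p)
  qed
  then have "f' = (\<lambda>h. \<Sum>k\<in>UNIV. h $ k * partial k f y)" by auto
  then show ?thesis using f' by simp
qed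

lemma partial_eqI:
  fixes f :: "real^'n \<Rightarrow> real"
  assumes "(f has_derivative f') (at y)"
  shows "partial k f y = f' (axis k 1)"
proof -
  have "f differentiable (at y)" using assms by (auto simp: differentiable_def)
  from has_derivative_unique[OF assms has_derivative_partials[OF this]]
  show ?thesis by (simp add: axis_def if_distrib if_distribR cong: if_cong)
qed

lemma line_derivative:
  fixes f :: "real^'n \<Rightarrow> real"
  assumes "f differentiable (at (x + t *\<^sub>R v))"
  shows "((\<lambda>t. f (x + t *\<^sub>R v)) has_real_derivative
           (\<Sum>k\<in>UNIV. v $ k * partial k f (x + t *\<^sub>R v))) (at t)"
proof -
  have "((\<lambda>t. f (x + t *\<^sub>R v)) has_derivative
      (\<lambda>s. \<Sum>k\<in>UNIV. (s *\<^sub>R v) $ k * partial k f (x + t *\<^sub>R v))) (at t)"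
    by (rule has_derivative_compose[where g = f and f = "\<lambda>t. x + t *\<^sub>R v", OF _ has_derivative_partials[OF assms]])
       (auto intro!: derivative_eq_intros)
  moreover have "(\<lambda>s. \<Sum>k\<in>UNIV. (s *\<^sub>R v) $ k * partial k f (x + t *\<^sub>R v)) =
      (*) (\<Sum>k\<in>UNIV. v $ k * partial k f (x + t *\<^sub>R v))"
    by (simp add: fun_eq_iff sum_distrib_left mult_ac)
  ultimately show ?thesis by (simp add: has_field_derivative_def)
qed

lemma partial_cong:
  fixes f g :: "real^'n \<Rightarrow> real"
  assumes "open S" "x \<in> S" "\<And>y. y \<in> S \<Longrightarrow> f y = g y"
  shows "partial k f x = partial k g x"
proof -
  have "open ((\<lambda>t. x + t *\<^sub>R axis k (1::real)) -` S)"
    by (intro open_vimage assms continuous_intros)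
  then have "eventually (\<lambda>t::real. x + t *\<^sub>R axis k 1 \<in> S) (nhds 0)"
    using assms(2) by (simp add: eventually_nhds) (metis (no_types, lifting) mem_Collect_eq scaleR_zero_left add_0_right vimage_Collect_eq vimage_def)
  then have "eventually (\<lambda>t. f (x + t *\<^sub>R axis k 1) = g (x + t *\<^sub>R axis k 1)) (nhds 0)"
    by (rule eventually_mono) (use assms(3) in auto)
  then show ?thesis unfolding partial_def by (rule deriv_cong_ev) simp
qed

lemma smooth_differentiable: "smooth_on S f \<Longrightarrow> x \<in> S \<Longrightarrow> f differentiable (at x)"
  using partials_Nil by (metis smooth_on_def)

lemma smooth_partial: "smooth_on S f \<Longrightarrow> smooth_on S (partial k f)"
  unfolding smooth_on_def by (metis partials_snoc)

lemma smooth_subset: "smooth_on S f \<Longrightarrow> T \<subseteq> S \<Longrightarrow> smooth_on T f"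
  by (auto simp: smooth_on_def)

lemma smooth_continuous: "smooth_on S f \<Longrightarrow> continuous_on S f"
  by (meson continuous_at_imp_continuous_on differentiable_imp_continuous_within smooth_differentiable)

subsection \<open>Closure properties of smoothness\<close>

text \<open>\<open>smooth_on\<close> reduced to finite orders: the product rule involves all pairs of lower derivatives, so
  closure under products is proved by induction on the order, for all factors at once.\<close>

primrec differentiable_order :: "nat \<Rightarrow> (real^'n) set \<Rightarrow> (real^'n \<Rightarrow> real) \<Rightarrow> bool" where
  "differentiable_order 0 S f \<longleftrightarrow> (\<forall>x\<in>S. f differentiable (at x))"
| "differentiable_order (Suc m) S f \<longleftrightarrow>
     (\<forall>x\<in>S. f differentiable (at x)) \<and> (\<forall>k. differentiable_order m S (partial k f))"

lemma differentiable_order_differentiable: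
  "differentiable_order m S f \<Longrightarrow> x \<in> S \<Longrightarrow> f differentiable (at x)"
  by (cases m) auto

lemma differentiable_order_lower: "differentiable_order (Suc m) S f \<Longrightarrow> differentiable_order m S f"
  by (induction m arbitrary: f) auto

lemma smooth_on_iff_order: "smooth_on S f \<longleftrightarrow> (\<forall>m. differentiable_order m S f)"
proof
  assume "smooth_on S f"
  then show "\<forall>m. differentiable_order m S f"
  proof (intro allI)
    fix m show "smooth_on S f \<Longrightarrow> differentiable_order m S f"
      by (induction m arbitrary: f) (auto intro: smooth_differentiable smooth_partial)
  qed
next
  assume *: "\<forall>m. differentiable_order m S f"
  have "\<forall>x\<in>S. partials ks f differentiable (at x)" for ks
    using *
  proof (induction ks arbitrary: f rule: rev_induct)
    case Nil
    then show ?case by (auto simp: partials_Nil intro: differentiable_order_differentiable)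
  next
    case (snoc k ks)
    have "\<forall>m. differentiable_order m S (partial k f)"
      using snoc.prems by (metis differentiable_order.simps(2))
    then show ?case using snoc.IH by (simp add: partials_snoc)
  qed
  then show "smooth_on S f" by (simp add: smooth_on_def)
qed

lemma differentiable_order_cong:
  assumes "open S" "\<And>y. y \<in> S \<Longrightarrow> f y = g y" "differentiable_order m S f"
  shows "differentiable_order m S g"
  using assms(2,3)
proof (induction m arbitrary: f g)
  case 0
  then show ?case using assms(1)
    unfolding differentiable_order.simps differentiable_def
    by (metis has_derivative_transform_within_open)
next
  case (Suc m)
  have "differentiable_order m S (partial k g)" for k
    by (rule Suc.IH[of "partial k f"])
       (use Suc.prems partial_cong[OF assms(1), of _ f g] in auto)
  moreover have "\<forall>x\<in>S. g differentiable (at x)"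
    using Suc.prems assms(1)
    unfolding differentiable_order.simps differentiable_def
    by (metis has_derivative_transform_within_open)
  ultimately show ?case by simp
qed

lemma smooth_cong:
  assumes "open S" "\<And>y. y \<in> S \<Longrightarrow> f y = g y" "smooth_on S f"
  shows "smooth_on S g"
  using assms differentiable_order_cong unfolding smooth_on_iff_order by metis

lemma partial_const: "partial k (\<lambda>_. c) = (\<lambda>_. 0)"
  by (simp add: partial_def fun_eq_iff)

lemma partial_add:
  assumes "f differentiable (at x)" "g differentiable (at x)"
  shows "partial k (\<lambda>x. f x + g x) x = partial k f x + partial k g x"
  by (subst partial_eqI[OF has_derivative_add[OF assms[THEN has_derivative_partials]]])
     (simp add: axis_def if_distrib if_distribR cong: if_cong)

lemma partial_mult:
  assumes "f differentiable (at x)" "g differentiable (at x)"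
  shows "partial k (\<lambda>x. f x * g x) x = f x * partial k g x + partial k f x * g x"
  by (subst partial_eqI[OF has_derivative_mult[OF assms[THEN has_derivative_partials]]])
     (simp add: axis_def if_distrib if_distribR cong: if_cong)

lemma smooth_const: "smooth_on S (\<lambda>_. c)"
proof -
  have "differentiable_order m S (\<lambda>_. c)" for m and c
    by (induction m arbitrary: c) (auto simp: partial_const)
  then show ?thesis by (simp add: smooth_on_iff_order)
qed

lemma differentiable_order_add:
  assumes "open S" "differentiable_order m S f" "differentiable_order m S g"
  shows "differentiable_order m S (\<lambda>x. f x + g x)"
  using assms(2,3)
proof (induction m arbitrary: f g)
  case (Suc m)
  have "differentiable_order m S (partial k (\<lambda>x. f x + g x))" for k
    by (rule differentiable_order_cong[OF assms(1) _ Suc.IH[of "partial k f" "partial k g"]])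
       (use Suc.prems in \<open>auto simp: partial_add\<close>)
  then show ?case using Suc.prems by auto
qed auto

lemma differentiable_order_mult:
  assumes "open S" "differentiable_order m S f" "differentiable_order m S g"
  shows "differentiable_order m S (\<lambda>x. f x * g x)"
  using assms(2,3)
proof (induction m arbitrary: f g)
  case (Suc m)
  have "differentiable_order m S (partial k (\<lambda>x. f x * g x))" for k
    by (rule differentiable_order_cong[OF assms(1) _ differentiable_order_add[OF assms(1)
          Suc.IH[of f "partial k g"] Suc.IH[of "partial k f" g]]])
       (use Suc.prems differentiable_order_lower in \<open>auto simp: partial_mult\<close>)
  then show ?case using Suc.prems by auto
qed auto

lemma smooth_add: "open S \<Longrightarrow> smooth_on S f \<Longrightarrow> smooth_on S g \<Longrightarrow> smooth_on S (\<lambda>x. f x + g x)"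
  by (simp add: smooth_on_iff_order differentiable_order_add)

lemma smooth_mult: "open S \<Longrightarrow> smooth_on S f \<Longrightarrow> smooth_on S g \<Longrightarrow> smooth_on S (\<lambda>x. f x * g x)"
  by (simp add: smooth_on_iff_order differentiable_order_mult)

lemma smooth_diff:
  assumes "open S" "smooth_on S f" "smooth_on S g"
  shows "smooth_on S (\<lambda>x. f x - g x)"
  using smooth_add[OF assms(1,2) smooth_mult[OF assms(1) smooth_const[of S "-1"] assms(3)]] by simp

lemma smooth_sum:
  assumes "open S" "\<And>i. i \<in> I \<Longrightarrow> smooth_on S (f i)"
  shows "smooth_on S (\<lambda>x. \<Sum>i\<in>I. f i x)"
  using assms(2) by (induction I rule: infinite_finite_induct) (auto intro: smooth_const smooth_add assms(1))

lemma partial_coordinate: "partial k (\<lambda>x. x $ i) = (\<lambda>_. if i = k then 1 else 0)"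
  by (rule ext, subst partial_eqI[where f' = "\<lambda>x. x $ i"])
     (auto simp: axis_def intro: bounded_linear_imp_has_derivative bounded_linear_vec_nth)

lemma smooth_coordinate: "smooth_on S (\<lambda>x. x $ i)"
proof -
  have d: "\<forall>x\<in>S. (\<lambda>x. x $ i) differentiable (at x)"
    by (auto intro: bounded_linear_imp_differentiable bounded_linear_vec_nth)
  have "differentiable_order m S (\<lambda>x. x $ i)" for m
    using d smooth_const[of S] by (cases m) (auto simp: partial_coordinate smooth_on_iff_order)
  then show ?thesis by (simp add: smooth_on_iff_order)
qed

lemmas smooth_intros = smooth_const smooth_add smooth_mult smooth_diff smooth_sum smooth_coordinate
  smooth_partial

lemma partial_sum:
  assumes "\<And>i. i \<in> I \<Longrightarrow> f i differentiable (at x)"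
  shows "partial k (\<lambda>x. \<Sum>i\<in>I. f i x) x = (\<Sum>i\<in>I. partial k (f i) x)"
  by (subst partial_eqI[OF has_derivative_sum[OF has_derivative_partials[OF assms]]])
     (auto simp: axis_def if_distrib if_distribR cong: if_cong)

lemma partial_cmult:
  assumes "f differentiable (at x)"
  shows "partial k (\<lambda>x. c * f x) x = c * partial k f x"
  by (subst partial_mult[OF differentiable_const assms]) (simp add: partial_const)

lemma partial_diff:
  assumes "f differentiable (at x)" "g differentiable (at x)"
  shows "partial k (\<lambda>x. f x - g x) x = partial k f x - partial k g x"
  by (subst partial_eqI[OF has_derivative_diff[OF assms[THEN has_derivative_partials]]])
     (simp add: axis_def if_distrib if_distribR cong: if_cong)

subsection \<open>Symmetry of second derivatives\<close>

text \<open>The second difference quotient over a square is a value of either mixed derivative in the square: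
  two applications of the mean value theorem.\<close>

lemma second_difference_mvt:
  fixes f :: "real^'n \<Rightarrow> real"
  assumes sm: "smooth_on S f" and h: "0 < h"
    and sub: "\<And>s t. 0 \<le> s \<Longrightarrow> s \<le> h \<Longrightarrow> 0 \<le> t \<Longrightarrow> t \<le> h \<Longrightarrow> x + s *\<^sub>R axis i 1 + t *\<^sub>R axis j 1 \<in> S"
  shows "\<exists>s t. 0 < s \<and> s < h \<and> 0 < t \<and> t < h \<and>
     f (x + h *\<^sub>R axis i 1 + h *\<^sub>R axis j 1) - f (x + h *\<^sub>R axis i 1) - f (x + h *\<^sub>R axis j 1) + f x
       = h * h * partial j (partial i f) (x + s *\<^sub>R axis i 1 + t *\<^sub>R axis j 1)"
proof -
  have ax: "(\<Sum>k\<in>UNIV. (axis i 1 :: real^'n) $ k * c k) = c i" for i c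
    by (simp add: axis_def if_distrib if_distribR cong: if_cong)
  let ?P = "\<lambda>s t. x + s *\<^sub>R axis i 1 + t *\<^sub>R axis j (1::real)"
  have P': "?P s t = (x + t *\<^sub>R axis j 1) + s *\<^sub>R axis i 1" for s t by simp
  have d1: "((\<lambda>s. f (?P s t)) has_real_derivative partial i f (?P s t)) (at s)"
    if "0 \<le> s" "s \<le> h" "0 \<le> t" "t \<le> h" for s t
    using line_derivative[OF smooth_differentiable[OF sm sub[OF that, unfolded P']]]
    unfolding P' ax by simp
  have d2: "((\<lambda>t. partial i f (?P s t)) has_real_derivative partial j (partial i f) (?P s t)) (at t)"
    if "0 \<le> s" "s \<le> h" "0 \<le> t" "t \<le> h" for s t
    using line_derivative[OF smooth_differentiable[OF smooth_partial[OF sm] sub[OF that]]]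
    unfolding ax by simp
  have "\<exists>s>0. s < h \<and> (f (?P h h) - f (?P h 0)) - (f (?P 0 h) - f (?P 0 0))
      = (h - 0) * (partial i f (?P s h) - partial i f (?P s 0))"
    by (rule MVT2[OF h]) (intro DERIV_diff d1; use h in simp)
  then obtain s where s: "0 < s" "s < h" and e1: "(f (?P h h) - f (?P h 0)) - (f (?P 0 h) - f (?P 0 0))
      = (h - 0) * (partial i f (?P s h) - partial i f (?P s 0))" by blast
  have "\<exists>t>0. t < h \<and> partial i f (?P s h) - partial i f (?P s 0)
      = (h - 0) * partial j (partial i f) (?P s t)"
    by (rule MVT2[OF h]) (intro d2; use s in simp)
  then obtain t where t: "0 < t" "t < h" and e2: "partial i f (?P s h) - partial i f (?P s 0)
      = (h - 0) * partial j (partial i f) (?P s t)" by blast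
  from e1 e2 s t show ?thesis
    by (intro exI[of _ s] exI[of _ t]) (simp add: algebra_simps)
qed

lemma partial_commute:
  fixes f :: "real^'n \<Rightarrow> real"
  assumes S: "open S" and sm: "smooth_on S f" and x: "x \<in> S"
  shows "partial i (partial j f) x = partial j (partial i f) x"
proof (rule ccontr)
  assume ne: "\<not> ?thesis"
  let ?e = "\<bar>partial i (partial j f) x - partial j (partial i f) x\<bar> / 2"
  have e: "?e > 0" using ne by simp
  have near: "\<exists>d>0. \<forall>y\<in>S. dist y x < d \<longrightarrow> \<bar>partial k (partial l f) y - partial k (partial l f) x\<bar> < ?e" for k l
    using smooth_continuous[OF smooth_partial[OF smooth_partial[OF sm]], of k l] x e
    unfolding continuous_on_iff dist_real_def by blast
  obtain d1 where d1: "d1 > 0" "\<And>y. y \<in> S \<Longrightarrow> dist y x < d1 \<Longrightarrow>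
      \<bar>partial i (partial j f) y - partial i (partial j f) x\<bar> < ?e" using near by blast
  obtain d2 where d2: "d2 > 0" "\<And>y. y \<in> S \<Longrightarrow> dist y x < d2 \<Longrightarrow>
      \<bar>partial j (partial i f) y - partial j (partial i f) x\<bar> < ?e" using near by blast
  obtain d3 where d3: "d3 > 0" "ball x d3 \<subseteq> S" using S x open_contains_ball by blast
  define d where "d = min d1 (min d2 d3)"
  define h where "h = d / 3"
  have h: "h > 0" using d1 d2 d3 by (simp add: h_def d_def)
  have dist: "dist (x + s *\<^sub>R axis a 1 + t *\<^sub>R axis b 1) x < d"
    if "0 \<le> s" "s \<le> h" "0 \<le> t" "t \<le> h" for s t and a b :: 'n
  proof -
    have "norm (s *\<^sub>R axis a (1::real) + t *\<^sub>R axis b 1 :: real^'n) \<le> s + t"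
      using norm_triangle_ineq[of "s *\<^sub>R axis a (1::real)" "t *\<^sub>R axis b 1"] that by simp
    also have "\<dots> < d" using that h by (simp add: h_def)
    finally show ?thesis by (simp add: dist_norm add.assoc)
  qed
  have sub: "x + s *\<^sub>R axis a 1 + t *\<^sub>R axis b 1 \<in> S"
    if "0 \<le> s" "s \<le> h" "0 \<le> t" "t \<le> h" for s t and a b :: 'n
    using dist[OF that, of a b] d3(2) by (auto simp: d_def dist_commute)
  let ?\<Delta> = "\<lambda>i j. f (x + h *\<^sub>R axis i 1 + h *\<^sub>R axis j 1) - f (x + h *\<^sub>R axis i 1) - f (x + h *\<^sub>R axis j 1) + f x"
  obtain s t where st: "0 < s" "s < h" "0 < t" "t < h"
    "?\<Delta> i j = h * h * partial j (partial i f) (x + s *\<^sub>R axis i 1 + t *\<^sub>R axis j 1)"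
    using second_difference_mvt[OF sm h sub, of i j] by blast
  obtain s' t' where st': "0 < s'" "s' < h" "0 < t'" "t' < h"
    "?\<Delta> j i = h * h * partial i (partial j f) (x + s' *\<^sub>R axis j 1 + t' *\<^sub>R axis i 1)"
    using second_difference_mvt[OF sm h sub, of j i] by blast
  have "?\<Delta> i j = ?\<Delta> j i" by (simp add: ac_simps)
  then have eq: "partial j (partial i f) (x + s *\<^sub>R axis i 1 + t *\<^sub>R axis j 1)
      = partial i (partial j f) (x + s' *\<^sub>R axis j 1 + t' *\<^sub>R axis i 1)"
    using st(5) st'(5) h by simp
  have "\<bar>partial j (partial i f) (x + s *\<^sub>R axis i 1 + t *\<^sub>R axis j 1) - partial j (partial i f) x\<bar> < ?e"
    using sub[of s t i j] dist[of s t i j] st by (intro d2(2)) (auto simp: d_def)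
  moreover have "\<bar>partial i (partial j f) (x + s' *\<^sub>R axis j 1 + t' *\<^sub>R axis i 1) - partial i (partial j f) x\<bar> < ?e"
    using sub[of s' t' j i] dist[of s' t' j i] st' by (intro d1(2)) (auto simp: d_def)
  ultimately show False using eq by (simp add: abs_if split: if_splits)
qed

subsection \<open>Conditions at an interior maximum\<close>

text \<open>The first and second derivative tests for functions of one variable, on lines through the point.\<close>

lemma interior_max_derivatives:
  fixes f :: "real^'n \<Rightarrow> real"
  assumes S: "open S" and sm: "smooth_on S f" and x: "x \<in> S" and max: "\<And>y. y \<in> S \<Longrightarrow> f y \<le> f x"
  shows "partial k f x = 0"
    and "(\<Sum>i\<in>UNIV. \<Sum>j\<in>UNIV. v $ i * v $ j * partial i (partial j f) x) \<le> 0"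
proof -
  obtain e where e: "e > 0" "ball x e \<subseteq> S" using S x open_contains_ball by blast
  have line: "\<exists>d>0. \<forall>t. \<bar>t\<bar> < d \<longrightarrow> x + t *\<^sub>R v \<in> S" for v
  proof (intro exI conjI allI impI)
    have n: "norm v + 1 > 0" by (smt (verit) norm_ge_zero)
    show "e / (norm v + 1) > 0" using e n by simp
    fix t :: real assume t: "\<bar>t\<bar> < e / (norm v + 1)"
    have "\<bar>t\<bar> * norm v \<le> \<bar>t\<bar> * (norm v + 1)" by (intro mult_left_mono) auto
    also have "\<dots> < e" using t n by (simp add: pos_less_divide_eq)
    finally show "x + t *\<^sub>R v \<in> S" using e by (auto simp: subset_iff dist_norm)
  qed
  show "partial k f x = 0"
  proof -
    obtain d where d: "d > 0" "\<And>t. \<bar>t\<bar> < d \<Longrightarrow> x + t *\<^sub>R axis k 1 \<in> S" using line by blast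
    have "((\<lambda>t. f (x + t *\<^sub>R axis k 1)) has_real_derivative
       (\<Sum>m\<in>UNIV. axis k 1 $ m * partial m f (x + 0 *\<^sub>R axis k 1))) (at 0)"
      by (rule line_derivative) (use sm x smooth_differentiable in auto)
    from DERIV_local_max[OF this d(1)] d(2) max
    have "(\<Sum>m\<in>UNIV. axis k (1::real) $ m * partial m f (x + 0 *\<^sub>R axis k 1)) = 0" by simp
    then show ?thesis by (simp add: axis_def if_distrib if_distribR cong: if_cong)
  qed
  obtain d where d: "d > 0" "\<And>t. \<bar>t\<bar> < d \<Longrightarrow> x + t *\<^sub>R v \<in> S" using line by blast
  let ?\<phi> = "\<lambda>t. f (x + t *\<^sub>R v)"
  let ?\<phi>1 = "\<lambda>t. \<Sum>j\<in>UNIV. v $ j * partial j f (x + t *\<^sub>R v)"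
  let ?c = "\<Sum>i\<in>UNIV. \<Sum>j\<in>UNIV. v $ i * v $ j * partial i (partial j f) x"
  have D1: "(?\<phi> has_real_derivative ?\<phi>1 t) (at t)" if "\<bar>t\<bar> < d" for t
    by (rule line_derivative) (use that d sm smooth_differentiable in auto)
  have "(?\<phi>1 has_real_derivative (\<Sum>j\<in>UNIV. v $ j * (\<Sum>i\<in>UNIV. v $ i * partial i (partial j f) (x + 0 *\<^sub>R v)))) (at 0)"
    by (intro DERIV_sum DERIV_cmult line_derivative smooth_differentiable[OF smooth_partial[OF sm]]) (use x in simp)
  also have "(\<Sum>j\<in>UNIV. v $ j * (\<Sum>i\<in>UNIV. v $ i * partial i (partial j f) (x + 0 *\<^sub>R v))) = ?c"
    by (subst sum.swap) (simp add: sum_distrib_left mult_ac)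
  finally have D2: "(?\<phi>1 has_real_derivative ?c) (at 0)" .
  have z: "?\<phi>1 0 = 0"
    using DERIV_local_max[OF D1[of 0] d(1)] d max by simp
  show "?c \<le> 0"
  proof (rule ccontr)
    assume "\<not> ?c \<le> 0"
    then obtain r where r: "r > 0" "\<And>h. 0 < h \<Longrightarrow> h < r \<Longrightarrow> ?\<phi>1 0 < ?\<phi>1 (0 + h)"
      using DERIV_pos_inc_right[OF D2] by auto
    define b where "b = min r d / 2"
    have b: "0 < b" "b < r" "b < d" using r d by (auto simp: b_def min_def)
    have "\<exists>t>0. t < b \<and> ?\<phi> b - ?\<phi> 0 = (b - 0) * ?\<phi>1 t"
      by (rule MVT2[OF b(1)], rule D1) (use b in auto)
    then obtain t where t: "0 < t" "t < b" "?\<phi> b - ?\<phi> 0 = (b - 0) * ?\<phi>1 t" by blast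
    have "?\<phi>1 t > 0" using r(2)[of t] t b z by simp
    then have "(b - 0) * ?\<phi>1 t > 0" using b by simp
    then have "?\<phi> b > ?\<phi> 0" using t(3) by linarith
    then show False using max[OF d(2)[of b]] b by simp
  qed
qed

lemma constant_if_partials_zero:
  fixes f :: "real^'n \<Rightarrow> real"
  assumes "convex S" "smooth_on S f" "\<And>k x. x \<in> S \<Longrightarrow> partial k f x = 0" "x \<in> S" "y \<in> S"
  shows "f x = f y"
proof -
  have "(f has_derivative (\<lambda>h. 0)) (at z within S)" if "z \<in> S" for z
    using has_derivative_at_withinI[OF has_derivative_partials[OF smooth_differentiable[OF assms(2) that]], of S]
      assms(3)[OF that] by simp
  from has_derivative_zero_constant[OF assms(1) this] assms(4,5) show ?thesis by metis
qed

section \<open>Positive definite symmetric matrices\<close>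

lemma symmetric_inner:
  fixes A :: "real^'n^'n"
  assumes "transpose A = A"
  shows "(A *v x) \<bullet> y = x \<bullet> (A *v y)"
  by (metis assms dot_lmul_matrix transpose_matrix_vector)

lemma symmetricI:
  fixes A :: "real^'n^'n"
  shows "(\<And>i j. A $ i $ j = A $ j $ i) \<Longrightarrow> transpose A = A"
  by (simp add: transpose_def vec_eq_iff)

lemma symmetricD:
  fixes A :: "real^'n^'n"
  shows "transpose A = A \<Longrightarrow> A $ i $ j = A $ j $ i"
  by (metis transpose_def vec_lambda_beta)

lemma quadratic_form_sum:
  fixes A :: "real^'n^'n"
  shows "v \<bullet> (A *v w) = (\<Sum>i\<in>UNIV. \<Sum>j\<in>UNIV. v $ i * w $ j * A $ i $ j)"
  by (simp add: inner_vec_def matrix_vector_mult_def sum_distrib_left mult_ac)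

subsection \<open>The spectral theorem\<close>

text \<open>An eigenvector is a maximum point of the quadratic form on the unit sphere of the subspace; the first
  variation there is a vector of the subspace orthogonal to the subspace.\<close>

lemma eigenvector_in_subspace:
  fixes A :: "real^'n^'n"
  assumes S: "subspace S" and sym: "transpose A = A" and inv: "\<And>x. x \<in> S \<Longrightarrow> A *v x \<in> S"
    and z: "z \<in> S" "z \<noteq> 0"
  shows "\<exists>x\<in>S. norm x = 1 \<and> (\<exists>\<mu>. A *v x = \<mu> *\<^sub>R x)"
proof -
  let ?K = "S \<inter> sphere 0 1"
  have "compact ?K" using closed_subspace[OF S] by (simp add: closed_Int_compact)
  moreover have "(1 / norm z) *\<^sub>R z \<in> ?K" using z S by (simp add: subspace_scale)
  then have "?K \<noteq> {}" by blast
  moreover have "continuous_on ?K (\<lambda>x. x \<bullet> (A *v x))"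
    by (intro continuous_intros matrix_vector_mult_linear_continuous_on)
  ultimately obtain x where x: "x \<in> ?K" and max: "\<And>y. y \<in> ?K \<Longrightarrow> y \<bullet> (A *v y) \<le> x \<bullet> (A *v x)"
    using continuous_attains_sup[of ?K "\<lambda>x. x \<bullet> (A *v x)"] by metis
  define \<mu> where "\<mu> = x \<bullet> (A *v x)"
  have xx: "x \<bullet> x = 1" using x by (simp add: dot_square_norm)
  have le: "y \<bullet> (A *v y) \<le> \<mu> * (y \<bullet> y)" if "y \<in> S" for y
  proof (cases "y = 0")
    case False
    have "((1 / norm y) *\<^sub>R y) \<bullet> (A *v ((1 / norm y) *\<^sub>R y)) \<le> \<mu>"
      unfolding \<mu>_def by (rule max) (use that False S in \<open>simp add: subspace_scale\<close>)
    then have "(y \<bullet> (A *v y)) / (norm y)\<^sup>2 \<le> \<mu>"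
      by (simp add: matrix_vector_mult_scaleR power2_eq_square)
    then show ?thesis using False by (simp add: divide_le_eq dot_square_norm)
  qed simp
  define w where "w = A *v x - \<mu> *\<^sub>R x"
  have wS: "w \<in> S" using x S inv by (simp add: w_def subspace_diff subspace_scale)
  define c where "c = w \<bullet> (A *v w) - \<mu> * (w \<bullet> w)"
  have alg: "2 * t * W + t\<^sup>2 * (\<gamma> - \<mu> * W) \<le> 0"
    if "\<mu> + 2 * t * \<alpha> + t\<^sup>2 * \<gamma> \<le> \<mu> * (1 + 2 * t * \<beta> + t\<^sup>2 * W)" "W = \<alpha> - \<mu> * \<beta>"
    for t \<alpha> \<beta> \<gamma> W :: real
    using that(1) unfolding that(2) by (simp add: algebra_simps)
  have quad: "2 * t * (w \<bullet> w) + t\<^sup>2 * c \<le> 0" for t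
  proof -
    have "x + t *\<^sub>R w \<in> S" using x S wS by (simp add: subspace_add subspace_scale)
    from le[OF this]
    have "\<mu> + 2 * t * (w \<bullet> (A *v x)) + t\<^sup>2 * (w \<bullet> (A *v w)) \<le> \<mu> * (1 + 2 * t * (w \<bullet> x) + t\<^sup>2 * (w \<bullet> w))"
      using xx symmetric_inner[OF sym, of x w]
      by (simp add: matrix_vector_right_distrib matrix_vector_mult_scaleR inner_add_left
          inner_add_right \<mu>_def power2_eq_square algebra_simps inner_commute)
    moreover have "w \<bullet> w = w \<bullet> (A *v x) - \<mu> * (w \<bullet> x)"
      unfolding w_def by (simp add: inner_diff_right)
    ultimately show ?thesis unfolding c_def by (rule alg)
  qed
  have "w \<bullet> w = 0"
  proof (rule ccontr)
    assume "w \<bullet> w \<noteq> 0"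
    then have p: "w \<bullet> w > 0" by simp
    \<comment> \<open>This value of \<open>t\<close> makes the linear term dominate the quadratic one.\<close>
    define t where "t = (w \<bullet> w) / (\<bar>c\<bar> + 1)"
    have t: "t > 0" using p by (simp add: t_def)
    have "t * c \<ge> - (t * \<bar>c\<bar>)" using t by (simp add: abs_if)
    moreover have "t * (\<bar>c\<bar> + 1) = w \<bullet> w" by (simp add: t_def)
    then have "t * \<bar>c\<bar> + t = w \<bullet> w" by (simp add: algebra_simps)
    ultimately have "2 * (w \<bullet> w) + t * c > 0" using p t by linarith
    then have "t * (2 * (w \<bullet> w) + t * c) > 0" using t by simp
    then show False using quad[of t] by (simp add: algebra_simps power2_eq_square)
  qed
  then have "A *v x = \<mu> *\<^sub>R x" by (simp add: w_def)
  then show ?thesis using x by auto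
qed

text \<open>The orthogonal complement of a set of eigenvectors is invariant, so it contains the next eigenvector.\<close>

lemma orthonormal_eigenvectors:
  fixes A :: "real^'n^'n"
  assumes sym: "transpose A = A" and "k \<le> CARD('n)"
  shows "\<exists>B. finite B \<and> card B = k \<and> pairwise orthogonal B \<and> (\<forall>x\<in>B. norm x = 1 \<and> (\<exists>\<mu>. A *v x = \<mu> *\<^sub>R x))"
  using assms(2)
proof (induction k)
  case 0
  show ?case by (intro exI[of _ "{}"]) auto
next
  case (Suc k)
  then obtain B where B: "finite B" "card B = k" "pairwise orthogonal B"
    "\<And>x. x \<in> B \<Longrightarrow> norm x = 1 \<and> (\<exists>\<mu>. A *v x = \<mu> *\<^sub>R x)" by auto
  have "dim B < DIM(real^'n)"
    using dim_le_card[of B B] span_superset[of B] B Suc.prems by simp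
  then obtain z where z: "z \<noteq> 0" "\<And>y. y \<in> span B \<Longrightarrow> orthogonal z y"
    using orthogonal_to_subspace_exists by blast
  let ?S = "{x. \<forall>b\<in>B. b \<bullet> x = 0}"
  have "subspace ?S" by (auto simp: subspace_def inner_add_right)
  moreover have "A *v x \<in> ?S" if "x \<in> ?S" for x
    using that B(4) by (force simp: symmetric_inner[OF sym, symmetric])
  moreover have "z \<in> ?S" using z(2) span_base by (auto simp: orthogonal_def inner_commute)
  ultimately obtain x where x: "x \<in> ?S" "norm x = 1" "\<exists>\<mu>. A *v x = \<mu> *\<^sub>R x"
    using eigenvector_in_subspace[OF _ sym, of ?S z] z(1) by blast
  have "x \<notin> B" using x by auto
  show ?case
    by (rule exI[of _ "insert x B"])
       (use x B \<open>x \<notin> B\<close> in \<open>auto simp: pairwise_def orthogonal_def inner_commute\<close>)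
qed

definition eigensystem :: "real^'n^'n \<Rightarrow> ('n \<Rightarrow> real^'n) \<Rightarrow> ('n \<Rightarrow> real) \<Rightarrow> bool" where
  "eigensystem A e lam \<longleftrightarrow>
     (\<forall>i j. e i \<bullet> e j = (if i = j then 1 else 0)) \<and> (\<forall>k. A *v e k = lam k *\<^sub>R e k)"

theorem spectral_theorem:
  fixes A :: "real^'n^'n"
  assumes sym: "transpose A = A"
  obtains e lam where "eigensystem A e lam"
proof -
  obtain B where B: "finite B" "card B = CARD('n)" "pairwise orthogonal B"
    "\<And>x. x \<in> B \<Longrightarrow> norm x = 1 \<and> (\<exists>\<mu>. A *v x = \<mu> *\<^sub>R x)"
    using orthonormal_eigenvectors[OF sym order_refl] by blast
  obtain e where e: "bij_betw e (UNIV :: 'n set) B"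
    using finite_same_card_bij[of "UNIV :: 'n set" B] B by auto
  have eB: "e i \<in> B" for i using e by (auto simp: bij_betw_def)
  then have "\<forall>i. \<exists>\<mu>. A *v e i = \<mu> *\<^sub>R e i" using B(4) by blast
  then obtain lam where lam: "\<And>i. A *v e i = lam i *\<^sub>R e i" by metis
  have "e i \<bullet> e j = (if i = j then 1 else 0)" for i j
  proof (cases "i = j")
    case True
    then show ?thesis using B(4)[OF eB[of j]] by (simp add: dot_square_norm)
  next
    case False
    then have "e i \<noteq> e j" using e by (auto simp: bij_betw_def dest: injD)
    then show ?thesis using False B(3) eB by (auto simp: pairwise_def orthogonal_def)
  qed
  then show ?thesis using that[of e lam] lam by (simp add: eigensystem_def)
qed

context
  fixes A :: "real^'n^'n" and e :: "'n \<Rightarrow> real^'n" and lam :: "'n \<Rightarrow> real"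
  assumes es: "eigensystem A e lam"
begin

lemma eigensystem_orthonormal: "e i \<bullet> e j = (if i = j then 1 else 0)"
  using es by (simp add: eigensystem_def)

text \<open>For evaluating the diagonalised form at the basis vectors themselves.\<close>

lemma eigensystem_delta:
  "(\<Sum>k\<in>UNIV. c k * (e i \<bullet> e k)\<^sup>2) = c i"
proof -
  have "c k * (e i \<bullet> e k)\<^sup>2 = (if k = i then c k else 0)" for k
    by (auto simp: eigensystem_orthonormal)
  then show ?thesis by simp
qed

lemma eigensystem_matrix:
  defines "P \<equiv> (\<chi> i j. e j $ i) :: real^'n^'n"
  shows "transpose P ** P = mat 1" "P ** transpose P = mat 1"
    "A = P ** (\<chi> i j. if i = j then lam i else 0) ** transpose P"
proof -
  show 1: "transpose P ** P = mat 1"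
    using eigensystem_orthonormal
    by (simp add: vec_eq_iff matrix_matrix_mult_def transpose_def P_def mat_def inner_vec_def)
  then show 2: "P ** transpose P = mat 1" by (simp add: matrix_left_right_inverse)
  have "A ** P = P ** (\<chi> i j. if i = j then lam i else 0)"
  proof -
    have "(A ** P) $ i $ j = (A *v e j) $ i" for i j
      by (simp add: matrix_matrix_mult_def matrix_vector_mult_def P_def)
    moreover have "A *v e j = lam j *\<^sub>R e j" for j using es by (simp add: eigensystem_def)
    ultimately show ?thesis
      by (simp add: vec_eq_iff)
         (simp add: matrix_matrix_mult_def P_def if_distrib mult.commute cong: if_cong)
  qed
  then show "A = P ** (\<chi> i j. if i = j then lam i else 0) ** transpose P"
    by (metis 2 matrix_mul_assoc matrix_mul_rid)
qed

lemma eigensystem_entries: "A $ i $ j = (\<Sum>k\<in>UNIV. lam k * (e k $ i * e k $ j))"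
  unfolding eigensystem_matrix(3)
  by (simp add: matrix_matrix_mult_def transpose_def if_distrib mult_ac cong: if_cong)

lemma eigensystem_identity: "(mat 1 :: real^'n^'n) $ i $ j = (\<Sum>k\<in>UNIV. e k $ i * e k $ j)"
  unfolding eigensystem_matrix(2)[symmetric] by (simp add: matrix_matrix_mult_def transpose_def)

lemma eigensystem_weighted_form:
  "(\<Sum>i\<in>UNIV. \<Sum>j\<in>UNIV. v $ i * v $ j * (\<Sum>k\<in>UNIV. c k * (e k $ i * e k $ j)))
      = (\<Sum>k\<in>UNIV. c k * (v \<bullet> e k)\<^sup>2)"
proof -
  have "(\<Sum>j\<in>UNIV. v $ i * v $ j * (\<Sum>k\<in>UNIV. c k * (e k $ i * e k $ j)))
     = (\<Sum>k\<in>UNIV. \<Sum>j\<in>UNIV. c k * ((v $ i * e k $ i) * (v $ j * e k $ j)))" for i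
    unfolding sum_distrib_left by (rule trans[OF sum.swap]) (simp add: mult_ac)
  then have "(\<Sum>i\<in>UNIV. \<Sum>j\<in>UNIV. v $ i * v $ j * (\<Sum>k\<in>UNIV. c k * (e k $ i * e k $ j)))
     = (\<Sum>i\<in>UNIV. \<Sum>k\<in>UNIV. \<Sum>j\<in>UNIV. c k * ((v $ i * e k $ i) * (v $ j * e k $ j)))"
    by simp
  also have "\<dots> = (\<Sum>k\<in>UNIV. \<Sum>i\<in>UNIV. \<Sum>j\<in>UNIV. c k * ((v $ i * e k $ i) * (v $ j * e k $ j)))"
    by (rule sum.swap)
  also have "\<dots> = (\<Sum>k\<in>UNIV. c k * (v \<bullet> e k)\<^sup>2)"
    by (simp only: inner_vec_def power2_eq_square sum_product) (simp add: sum_distrib_left)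
  finally show ?thesis .
qed

lemma eigensystem_form: "v \<bullet> (A *v v) = (\<Sum>k\<in>UNIV. lam k * (v \<bullet> e k)\<^sup>2)"
  unfolding quadratic_form_sum eigensystem_entries by (rule eigensystem_weighted_form)

lemma eigensystem_norm: "v \<bullet> v = (\<Sum>k\<in>UNIV. (v \<bullet> e k)\<^sup>2)"
proof -
  have "v \<bullet> v = v \<bullet> (mat 1 *v v)" by simp
  also have "\<dots> = (\<Sum>k\<in>UNIV. (v \<bullet> e k)\<^sup>2)"
    unfolding quadratic_form_sum eigensystem_identity
    using eigensystem_weighted_form[of v "\<lambda>_. 1"] by simp
  finally show ?thesis .
qed

lemma eigensystem_trace: "trace A = (\<Sum>k\<in>UNIV. lam k)"
  and eigensystem_trace_square: "trace (A ** A) = (\<Sum>k\<in>UNIV. (lam k)\<^sup>2)"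
  and eigensystem_det: "det A = (\<Prod>k\<in>UNIV. lam k)"
proof -
  let ?P = "(\<chi> i j. e j $ i) :: real^'n^'n"
  let ?D = "(\<chi> i j. if i = j then lam i else 0) :: real^'n^'n"
  have tr: "trace (?P ** M ** transpose ?P) = trace M" for M :: "real^'n^'n"
    by (metis eigensystem_matrix(1) matrix_mul_assoc matrix_mul_lid trace_mul_sym)
  show "trace A = (\<Sum>k\<in>UNIV. lam k)"
    by (subst eigensystem_matrix(3), subst tr) (simp add: trace_def)
  have "A ** A = ?P ** (?D ** ?D) ** transpose ?P"
  proof -
    have "A ** A = (?P ** ?D ** transpose ?P) ** (?P ** ?D ** transpose ?P)"
      by (simp only: eigensystem_matrix(3)[symmetric])
    also have "\<dots> = ?P ** (?D ** (transpose ?P ** ?P) ** ?D) ** transpose ?P"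
      by (simp only: matrix_mul_assoc)
    finally show ?thesis by (simp only: eigensystem_matrix(1) matrix_mul_rid)
  qed
  then show "trace (A ** A) = (\<Sum>k\<in>UNIV. (lam k)\<^sup>2)"
    by (simp add: tr) (simp add: trace_def matrix_matrix_mult_def power2_eq_square if_distrib cong: if_cong)
  have "det ?P * det ?P = 1"
    by (metis eigensystem_matrix(1) det_I det_mul det_transpose)
  then show "det A = (\<Prod>k\<in>UNIV. lam k)"
    by (subst eigensystem_matrix(3)) (simp add: det_mul det_diagonal)
qed

lemma eigenvalues_positive: "pos_def A \<Longrightarrow> lam i > 0"
proof -
  assume "pos_def A"
  moreover have "e i \<noteq> 0" using eigensystem_orthonormal[of i i] by auto
  ultimately have "e i \<bullet> (A *v e i) > 0" by (simp add: pos_def_def)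
  then show ?thesis unfolding eigensystem_form eigensystem_delta .
qed

end

subsection \<open>Inequalities for positive definite matrices of determinant one\<close>

lemma sum_ln_eigenvalues:
  fixes lam :: "'n::finite \<Rightarrow> real"
  assumes "\<And>i. lam i > 0" "(\<Prod>i\<in>UNIV. lam i) = 1"
  shows "(\<Sum>i\<in>UNIV. ln (lam i)) = 0"
  using assms ln_prod[of UNIV lam] by (metis UNIV_I finite ln_one less_irrefl)

text \<open>The inequality between arithmetic and geometric means of the eigenvalues, as the sum of the inequalities
  \<open>ln \<lambda> \<le> \<lambda> - 1\<close>.\<close>

lemma trace_ge_card:
  fixes A :: "real^'n^'n"
  assumes "transpose A = A" "pos_def A" "det A = 1"
  shows "trace A \<ge> CARD('n)"
proof -
  obtain e lam where s: "eigensystem A e lam"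
    using spectral_theorem[OF assms(1)] .
  note pos = eigenvalues_positive[OF s assms(2)]
  have "0 = (\<Sum>k\<in>UNIV. ln (lam k))" using sum_ln_eigenvalues[of lam] pos eigensystem_det[OF s] assms(3) by simp
  also have "\<dots> \<le> (\<Sum>k\<in>UNIV. lam k - 1)"
    by (intro sum_mono ln_le_minus_one pos)
  finally show ?thesis by (simp add: eigensystem_trace[OF s] sum_subtractf)
qed

text \<open>Maclaurin's inequality \<open>\<sigma>\<^sub>2 \<ge> n (n - 1) / 2\<close> at determinant one: sum \<open>ln (\<lambda>\<^sub>i \<lambda>\<^sub>j) \<le> \<lambda>\<^sub>i \<lambda>\<^sub>j - 1\<close> over all
  \<open>i \<noteq> j\<close>; the logarithms cancel.  Equality forces \<open>\<lambda>\<^sub>i \<lambda>\<^sub>j = 1\<close> for all \<open>i \<noteq> j\<close>, which for at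
  least three eigenvalues makes all of them equal to one.\<close>

lemma maclaurin_second:
  fixes A :: "real^'n^'n"
  assumes "transpose A = A" "pos_def A" "det A = 1"
  shows "(trace A)\<^sup>2 - trace (A ** A) \<ge> CARD('n) * (real CARD('n) - 1)"
    and "(trace A)\<^sup>2 - trace (A ** A) = CARD('n) * (real CARD('n) - 1) \<Longrightarrow> CARD('n) \<ge> 3 \<Longrightarrow> A = mat 1"
proof -
  obtain e lam where s: "eigensystem A e lam"
    using spectral_theorem[OF assms(1)] .
  note pos = eigenvalues_positive[OF s assms(2)]
  have ln0: "(\<Sum>k\<in>UNIV. ln (lam k)) = 0" using sum_ln_eigenvalues[of lam] pos eigensystem_det[OF s] assms(3) by simp
  define g where "g i j = lam i * lam j - 1 - (ln (lam i) + ln (lam j))" for i j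
  have g0: "g i j \<ge> 0" for i j
    using ln_le_minus_one[of "lam i * lam j"] pos[of i] pos[of j] by (simp add: g_def ln_mult_pos)
  have split: "(\<Sum>i\<in>UNIV. \<Sum>j\<in>UNIV. f i j) = (\<Sum>i\<in>UNIV. \<Sum>j\<in>UNIV - {i}. f i j) + (\<Sum>i\<in>UNIV. f i i)"
    for f :: "'n \<Rightarrow> 'n \<Rightarrow> real"
    by (simp add: sum_diff1 sum_subtractf)
  have all: "(\<Sum>i\<in>UNIV. \<Sum>j\<in>UNIV. g i j) = (trace A)\<^sup>2 - (real CARD('n))\<^sup>2"
    by (simp add: g_def sum_subtractf sum.distrib ln0 eigensystem_trace[OF s] power2_eq_square sum_product)
       (simp add: ln0 flip: sum_distrib_left)
  have ln2: "(\<Sum>k\<in>UNIV. 2 * ln (lam k)) = 0" by (simp add: ln0 flip: sum_distrib_left)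
  have diag: "(\<Sum>i\<in>UNIV. g i i) = trace (A ** A) - CARD('n)"
    by (simp add: g_def sum_subtractf sum.distrib ln0 ln2 eigensystem_trace_square[OF s] power2_eq_square)
  have eq: "(trace A)\<^sup>2 - trace (A ** A) - CARD('n) * (real CARD('n) - 1) = (\<Sum>i\<in>UNIV. \<Sum>j\<in>UNIV - {i}. g i j)"
    using split[of g] all diag by (simp add: power2_eq_square algebra_simps)
  have "(\<Sum>i\<in>UNIV. \<Sum>j\<in>UNIV - {i}. g i j) \<ge> 0" by (intro sum_nonneg g0)
  then show "(trace A)\<^sup>2 - trace (A ** A) \<ge> CARD('n) * (real CARD('n) - 1)" using eq by linarith
  assume h: "(trace A)\<^sup>2 - trace (A ** A) = CARD('n) * (real CARD('n) - 1)" and n3: "CARD('n) \<ge> 3"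
  have "(\<Sum>i\<in>UNIV. \<Sum>j\<in>UNIV - {i}. g i j) = 0" using h eq by simp
  then have "\<And>i. (\<Sum>j\<in>UNIV - {i}. g i j) = 0"
    by (subst (asm) sum_nonneg_eq_0_iff) (auto intro: sum_nonneg g0)
  then have gz: "g i j = 0" if "i \<noteq> j" for i j
    using that g0 by (subst (asm) sum_nonneg_eq_0_iff) auto
  have prod1: "lam i * lam j = 1" if "i \<noteq> j" for i j
  proof -
    have "ln (lam i * lam j) = lam i * lam j - 1"
      using gz[OF that] pos[of i] pos[of j] by (simp add: g_def ln_mult_pos)
    then show ?thesis using ln_eq_minus_one pos[of i] pos[of j] by simp
  qed
  have "lam i = 1" for i
  proof -
    have "card (UNIV - {i}) \<ge> 2" using n3 by (simp add: card_Diff_singleton)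
    then obtain j where j: "j \<in> UNIV - {i}" by (metis card.empty ex_in_conv not_numeral_le_zero)
    have "card (UNIV - {i} - {j}) \<ge> 1" using n3 j by (simp add: card_Diff_singleton)
    then obtain k where k: "k \<in> UNIV - {i} - {j}" by (metis card.empty ex_in_conv not_one_le_zero)
    have "lam i * lam j = 1" "lam i * lam k = 1" "lam j * lam k = 1" using j k by (auto intro!: prod1)
    moreover have "(lam i)\<^sup>2 * (lam j * lam k) = (lam i * lam j) * (lam i * lam k)"
      by (simp add: power2_eq_square)
    ultimately have "(lam i)\<^sup>2 = 1" by simp
    then show ?thesis using pos[of i] by (simp add: power2_eq_1_iff)
  qed
  then show "A = mat 1" by (simp add: vec_eq_iff eigensystem_entries[OF s] eigensystem_identity[OF s])
qed

subsection \<open>Contractions with positive definite matrices\<close>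

lemma pos_def_factor:
  fixes A :: "real^'n^'n"
  assumes "transpose A = A" "pos_def A"
  shows "\<exists>R :: real^'n^'n. A = R ** transpose R"
proof -
  obtain e lam where s: "eigensystem A e lam"
    using spectral_theorem[OF assms(1)] .
  note pos = eigenvalues_positive[OF s assms(2)]
  have "lam k * (e k $ i * e k $ j) = (sqrt (lam k) * e k $ i) * (sqrt (lam k) * e k $ j)" for i j k
  proof -
    have "sqrt (lam k) * sqrt (lam k) = lam k" using pos[of k] by simp
    then show ?thesis by (metis mult.assoc mult.left_commute)
  qed
  then have "A = (\<chi> i k. sqrt (lam k) * e k $ i) ** transpose (\<chi> i k. sqrt (lam k) * e k $ i)"
    by (simp only: vec_eq_iff eigensystem_entries[OF s] matrix_matrix_mult_def transpose_def vec_lambda_beta) simp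
  then show ?thesis by blast
qed

text \<open>With \<open>a = R R\<^sup>T\<close> the contraction is the sum of the values of the form \<open>H\<close> at the columns of \<open>R\<close>.\<close>

lemma contraction_nonpos:
  fixes a H :: "real^'n^'n"
  assumes "transpose a = a" "pos_def a"
    and H: "\<And>v. (\<Sum>i\<in>UNIV. \<Sum>j\<in>UNIV. v $ i * v $ j * H $ i $ j) \<le> 0"
  shows "(\<Sum>i\<in>UNIV. \<Sum>j\<in>UNIV. a $ i $ j * H $ i $ j) \<le> 0"
proof -
  obtain R :: "real^'n^'n" where R: "a = R ** transpose R" using pos_def_factor[OF assms(1,2)] by blast
  have "(\<Sum>i\<in>UNIV. \<Sum>j\<in>UNIV. a $ i $ j * H $ i $ j)
     = (\<Sum>i\<in>UNIV. \<Sum>j\<in>UNIV. \<Sum>k\<in>UNIV. R $ i $ k * R $ j $ k * H $ i $ j)"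
    by (simp add: R matrix_matrix_mult_def transpose_def sum_distrib_right)
  also have "\<dots> = (\<Sum>i\<in>UNIV. \<Sum>k\<in>UNIV. \<Sum>j\<in>UNIV. R $ i $ k * R $ j $ k * H $ i $ j)"
    by (intro sum.cong[OF refl] sum.swap)
  also have "\<dots> = (\<Sum>k\<in>UNIV. \<Sum>i\<in>UNIV. \<Sum>j\<in>UNIV. R $ i $ k * R $ j $ k * H $ i $ j)"
    by (rule sum.swap)
  also have "\<dots> \<le> 0"
  proof (rule sum_nonpos)
    fix k
    show "(\<Sum>i\<in>UNIV. \<Sum>j\<in>UNIV. R $ i $ k * R $ j $ k * H $ i $ j) \<le> 0"
      using H[of "column k R"] by (simp add: column_def)
  qed
  finally show ?thesis .
qed

text \<open>Reduction to one matrix: for \<open>a = R R\<^sup>T\<close> the trace of \<open>a B\<close> is that of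
  the congruent matrix \<open>R\<^sup>T B R\<close>, which is again positive definite of determinant one.\<close>

lemma trace_mult_ge_card:
  fixes a B :: "real^'n^'n"
  assumes "transpose a = a" "pos_def a" "det a = 1" "transpose B = B" "pos_def B" "det B = 1"
  shows "trace (a ** B) \<ge> CARD('n)"
proof -
  obtain R :: "real^'n^'n" where R: "a = R ** transpose R" using pos_def_factor[OF assms(1,2)] by blast
  have dR: "det R * det R = 1" using assms(3) by (simp add: R det_mul)
  let ?M = "transpose R ** B ** R"
  have "transpose ?M = ?M" using assms(4) by (simp add: matrix_transpose_mul matrix_mul_assoc)
  moreover have "pos_def ?M"
    unfolding pos_def_def
  proof (intro allI impI)
    fix v :: "real^'n" assume v: "v \<noteq> 0"
    have "invertible R" using dR by (auto simp: invertible_det_nz)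
    then have "R *v v \<noteq> 0" using v by (metis invertible_def matrix_left_invertible_ker)
    then have "(R *v v) \<bullet> (B *v (R *v v)) > 0" using assms(5) by (simp add: pos_def_def)
    also have "(R *v v) \<bullet> (B *v (R *v v)) = v \<bullet> (?M *v v)"
      by (metis dot_lmul_matrix matrix_vector_mul_assoc transpose_matrix_vector transpose_transpose)
    finally show "v \<bullet> (?M *v v) > 0" .
  qed
  moreover have "det ?M = 1" using dR assms(6) by (simp add: det_mul)
  ultimately have "trace ?M \<ge> CARD('n)" by (rule trace_ge_card)
  also have "trace ?M = trace (a ** B)"
    by (metis R matrix_mul_assoc trace_mul_sym)
  finally show ?thesis .
qed

text \<open>The largest eigenvalue is at most the trace when no eigenvalue is negative.\<close>

lemma psd_form_le_trace:
  fixes Q :: "real^'n^'n"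
  assumes sym: "transpose Q = Q" and psd: "\<And>v. v \<bullet> (Q *v v) \<ge> 0"
  shows "v \<bullet> (Q *v v) \<le> trace Q * (v \<bullet> v)"
proof -
  obtain e lam where s: "eigensystem Q e lam"
    using spectral_theorem[OF sym] .
  have pos: "lam i \<ge> 0" for i
    using psd[of "e i"] unfolding eigensystem_form[OF s] eigensystem_delta[OF s] .
  have "lam k * (v \<bullet> e k)\<^sup>2 \<le> lam k * (v \<bullet> v)" for k
    unfolding eigensystem_norm[OF s, of v] by (intro mult_left_mono pos member_le_sum) auto
  then show ?thesis unfolding eigensystem_form[OF s] eigensystem_trace[OF s] sum_distrib_right by (intro sum_mono) auto
qed

subsection \<open>Inverses\<close>

lemma matrix_inv_det:
  fixes A :: "real^'n^'n"
  assumes "det A \<noteq> 0"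
  shows "A ** matrix_inv A = mat 1" "matrix_inv A ** A = mat 1"
proof -
  have "\<exists>B :: real^'n^'n. A ** B = mat 1 \<and> B ** A = mat 1"
    using invertible_det_nz[of A] assms unfolding invertible_def by blast
  from someI_ex[OF this] show "A ** matrix_inv A = mat 1" "matrix_inv A ** A = mat 1"
    by (simp_all add: matrix_inv_def)
qed

lemma pos_def_inverse:
  fixes A :: "real^'n^'n"
  assumes sym: "transpose A = A" and pd: "pos_def A" and d: "det A = 1"
  shows "A ** matrix_inv A = mat 1" "matrix_inv A ** A = mat 1" "transpose (matrix_inv A) = matrix_inv A"
    "pos_def (matrix_inv A)" "det (matrix_inv A) = 1"
proof -
  show 1: "A ** matrix_inv A = mat 1" and 2: "matrix_inv A ** A = mat 1"
    using matrix_inv_det[of A] d by simp_all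
  show 3: "transpose (matrix_inv A) = matrix_inv A"
    by (metis 1 2 matrix_mul_assoc matrix_mul_lid matrix_mul_rid matrix_transpose_mul sym transpose_mat)
  show "pos_def (matrix_inv A)"
    unfolding pos_def_def
  proof (intro allI impI)
    fix v :: "real^'n" assume v: "v \<noteq> 0"
    let ?w = "matrix_inv A *v v"
    have Aw: "A *v ?w = v" by (simp add: matrix_vector_mul_assoc 1)
    then have "?w \<noteq> 0" using v by auto
    then have "?w \<bullet> (A *v ?w) > 0" using pd by (simp add: pos_def_def)
    then show "v \<bullet> ?w > 0" using Aw by (simp add: inner_commute)
  qed
  show "det (matrix_inv A) = 1" by (metis 1 d det_I det_mul mult_1)
qed

lemma continuous_on_det_entries:
  fixes M :: "'b::topological_space \<Rightarrow> real^'n^'n"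
  assumes "\<And>i j. continuous_on S (\<lambda>x. M x $ i $ j)"
  shows "continuous_on S (\<lambda>x. det (M x))"
  unfolding det_def by (intro continuous_intros assms)

text \<open>By Cramer's rule the entries of the inverse are determinants.\<close>

lemma continuous_on_matrix_inv:
  fixes M :: "'b::topological_space \<Rightarrow> real^'n^'n"
  assumes "\<And>i j. continuous_on S (\<lambda>x. M x $ i $ j)" "\<And>x. x \<in> S \<Longrightarrow> det (M x) = 1"
  shows "continuous_on S (\<lambda>x. matrix_inv (M x) $ i $ j)"
proof -
  let ?N = "\<lambda>x. (\<chi> r s. if s = i then axis j 1 $ r else M x $ r $ s) :: real^'n^'n"
  have "continuous_on S (\<lambda>x. det (?N x))"
  proof (rule continuous_on_det_entries)
    fix r s show "continuous_on S (\<lambda>x. ?N x $ r $ s)"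
      by (cases "s = i") (simp_all add: assms(1))
  qed
  moreover have "det (?N x) = matrix_inv (M x) $ i $ j" if "x \<in> S" for x
  proof -
    have nz: "det (M x) \<noteq> 0" using assms(2)[OF that] by simp
    then have "M x *v (matrix_inv (M x) *v axis j 1) = axis j 1"
      by (simp add: matrix_vector_mul_assoc matrix_inv_det)
    then have "matrix_inv (M x) *v axis j 1 = (\<chi> k. det (\<chi> r s. if s = k then axis j 1 $ r else M x $ r $ s) / det (M x))"
      using cramer[OF nz] by blast
    then have "(matrix_inv (M x) *v axis j 1) $ i = det (?N x)"
      by (simp add: assms(2)[OF that])
    then show ?thesis by (simp add: matrix_vector_mul_component inner_axis)
  qed
  ultimately show ?thesis by (simp cong: continuous_on_cong)
qed

subsection \<open>Two by two matrices\<close>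

lemma det_card_2:
  fixes A :: "real^'n^'n"
  assumes "(UNIV :: 'n set) = {i, j}" "i \<noteq> j"
  shows "det A = A $ i $ i * A $ j $ j - A $ i $ j * A $ j $ i"
proof -
  have "{p. p permutes (UNIV :: 'n set)} = {id, Transposition.transpose i j}"
    unfolding assms(1) by (auto simp: permutes_doubleton_iff)
  moreover have "id \<noteq> Transposition.transpose i j"
    using assms(2) by (metis id_apply transpose_apply_first)
  moreover have "(\<Prod>k\<in>UNIV. f k) = f i * f j" for f :: "'n \<Rightarrow> real"
    unfolding assms(1) using assms(2) by simp
  ultimately show ?thesis
    using assms(2) by (simp add: det_def sign_swap_id sign_id)
qed

section \<open>Maximum principles for second order operators\<close>

definition second_order :: "real^'n^'n \<Rightarrow> (real^'n \<Rightarrow> real) \<Rightarrow> real^'n \<Rightarrow> real" where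
  "second_order a f x = (\<Sum>i\<in>UNIV. \<Sum>j\<in>UNIV. a $ i $ j * partial i (partial j f) x)"

context
  fixes S :: "(real^'n) set"
  assumes S: "open S"
begin

lemma second_order_cong:
  assumes "x \<in> S" "\<And>y. y \<in> S \<Longrightarrow> f y = g y"
  shows "second_order a f x = second_order a g x"
proof -
  have "partial j f y = partial j g y" if "y \<in> S" for y j
    by (rule partial_cong[OF S that assms(2)])
  then have "partial i (partial j f) x = partial i (partial j g) x" for i j
    using partial_cong[OF S assms(1)] by blast
  then show ?thesis by (simp add: second_order_def)
qed

lemma second_partial_add:
  assumes "smooth_on S f" "smooth_on S g" "x \<in> S"
  shows "partial i (partial j (\<lambda>y. f y + g y)) x = partial i (partial j f) x + partial i (partial j g) x"
proof -
  have "partial i (partial j (\<lambda>y. f y + g y)) x = partial i (\<lambda>y. partial j f y + partial j g y) x"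
    by (rule partial_cong[OF S assms(3)]) (intro partial_add smooth_differentiable[OF assms(1)] smooth_differentiable[OF assms(2)])
  then show ?thesis
    by (simp add: partial_add[OF smooth_differentiable[OF smooth_partial[OF assms(1)] assms(3)]
          smooth_differentiable[OF smooth_partial[OF assms(2)] assms(3)]])
qed

lemma second_partial_mult:
  assumes "smooth_on S f" "smooth_on S g" "x \<in> S"
  shows "partial i (partial j (\<lambda>y. f y * g y)) x =
    f x * partial i (partial j g) x + partial i f x * partial j g x +
    partial j f x * partial i g x + partial i (partial j f) x * g x"
proof -
  have "partial i (partial j (\<lambda>y. f y * g y)) x = partial i (\<lambda>y. f y * partial j g y + partial j f y * g y) x"
    by (rule partial_cong[OF S assms(3)]) (intro partial_mult smooth_differentiable[OF assms(1)] smooth_differentiable[OF assms(2)])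
  also have "\<dots> = partial i (\<lambda>y. f y * partial j g y) x + partial i (\<lambda>y. partial j f y * g y) x"
    by (intro partial_add smooth_differentiable[OF _ assms(3)] smooth_mult S smooth_partial assms(1,2))
  finally show ?thesis
    by (simp add: partial_mult[OF smooth_differentiable[OF assms(1,3)] smooth_differentiable[OF smooth_partial[OF assms(2)] assms(3)]]
        partial_mult[OF smooth_differentiable[OF smooth_partial[OF assms(1)] assms(3)] smooth_differentiable[OF assms(2,3)]])
qed

lemma second_order_add:
  assumes "smooth_on S f" "smooth_on S g" "x \<in> S"
  shows "second_order a (\<lambda>y. f y + g y) x = second_order a f x + second_order a g x"
  by (simp add: second_order_def second_partial_add assms distrib_left sum.distrib)

lemma second_order_mult:
  assumes "smooth_on S f" "smooth_on S g" "x \<in> S" and sym: "transpose a = a"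
  shows "second_order a (\<lambda>y. f y * g y) x = f x * second_order a g x + g x * second_order a f x
     + 2 * (\<Sum>i\<in>UNIV. \<Sum>j\<in>UNIV. a $ i $ j * (partial i f x * partial j g x))"
proof -
  have "(\<Sum>i\<in>UNIV. \<Sum>j\<in>UNIV. a $ i $ j * (partial j f x * partial i g x))
      = (\<Sum>i\<in>UNIV. \<Sum>j\<in>UNIV. a $ i $ j * (partial i f x * partial j g x))"
    by (subst sum.swap) (simp add: symmetricD[OF sym])
  then show ?thesis
    unfolding second_order_def second_partial_mult[OF assms(1-3)]
    by (simp add: distrib_left sum.distrib sum_distrib_left mult_ac)
qed

lemma second_order_const: "second_order a (\<lambda>_. c) x = 0"
  by (simp add: second_order_def partial_const)

lemma second_order_cmult:
  assumes "smooth_on S f" "x \<in> S"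
  shows "second_order a (\<lambda>y. c * f y) x = c * second_order a f x"
  by (simp add: second_order_def second_partial_mult[OF smooth_const assms] partial_const sum_distrib_left mult_ac)

lemma second_order_diff:
  assumes "smooth_on S f" "smooth_on S g" "x \<in> S"
  shows "second_order a (\<lambda>y. f y - g y) x = second_order a f x - second_order a g x"
  using second_order_add[OF assms(1) smooth_mult[OF S smooth_const[of S "-1"] assms(2)] assms(3)]
    second_order_cmult[OF assms(2,3), of a "-1"] by simp

lemma second_order_sum:
  assumes "\<And>i. i \<in> I \<Longrightarrow> smooth_on S (f i)" "x \<in> S"
  shows "second_order a (\<lambda>y. \<Sum>i\<in>I. f i y) x = (\<Sum>i\<in>I. second_order a (f i) x)"
  using assms(1)
  by (induction I rule: infinite_finite_induct)
     (auto simp: second_order_const second_order_add smooth_sum[OF S] assms(2))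

text \<open>Both maximum principles end by contradicting this inequality with a strict one.\<close>

lemma second_order_at_max:
  assumes "smooth_on S f" "x \<in> S" "\<And>y. y \<in> S \<Longrightarrow> f y \<le> f x" "transpose a = a" "pos_def a"
  shows "second_order a f x \<le> 0"
  using contraction_nonpos[OF assms(4,5), of "\<chi> i j. partial i (partial j f) x"]
    interior_max_derivatives(2)[OF S assms(1-3)]
  by (simp add: second_order_def)

end

subsection \<open>Quadratic functions\<close>

definition quad :: "real^'n^'n \<Rightarrow> real^'n \<Rightarrow> real \<Rightarrow> real^'n \<Rightarrow> real" where
  "quad A c s x = (x - c) \<bullet> (A *v (x - c)) / 2 - s"

lemma smooth_quad:
  assumes "open S"
  shows "smooth_on S (quad A c s)"
proof -
  have eq: "quad A c s = (\<lambda>x. (1/2) * (\<Sum>i\<in>UNIV. \<Sum>j\<in>UNIV. (x $ i - c $ i) * (x $ j - c $ j) * A $ i $ j) - s)"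
    by (simp add: fun_eq_iff quad_def quadratic_form_sum)
  show ?thesis unfolding eq by (intro smooth_intros assms)
qed

lemma continuous_quad: "continuous_on S (quad A c s)"
  by (rule continuous_on_subset[OF smooth_continuous[OF smooth_quad[OF open_UNIV]]]) simp

lemma has_derivative_matrix_vector: "((\<lambda>x. A *v (x - c)) has_derivative (\<lambda>h. A *v h)) (at (x :: real^'n))"
  by (rule bounded_linear.has_derivative[OF matrix_vector_mul_bounded_linear[of A],
        where g = "\<lambda>x. x - c" and g' = "\<lambda>h. h"]) (auto intro!: derivative_eq_intros)

lemma partial_quad:
  fixes A :: "real^'n^'n"
  assumes "transpose A = A"
  shows "partial k (quad A c s) = (\<lambda>x. (A *v (x - c)) $ k)"
proof
  fix x
  have d: "(quad A c s has_derivative (\<lambda>h. ((x - c) \<bullet> (A *v h) + h \<bullet> (A *v (x - c))) / 2 - 0)) (at x)"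
    unfolding quad_def[abs_def]
    by (intro has_derivative_diff has_derivative_const has_derivative_divide' has_derivative_inner
        has_derivative_matrix_vector) (auto intro!: derivative_eq_intros has_derivative_matrix_vector)
  have "(x - c) \<bullet> (A *v axis k 1) = (A *v (x - c)) $ k"
    by (simp add: symmetric_inner[OF assms, symmetric] inner_axis)
  then show "partial k (quad A c s) x = (A *v (x - c)) $ k"
    by (subst partial_eqI[OF d]) (simp add: inner_axis')
qed

lemma second_partial_quad:
  fixes A :: "real^'n^'n"
  assumes "transpose A = A"
  shows "partial i (partial j (quad A c s)) = (\<lambda>x. A $ i $ j)"
proof
  fix x
  have d: "((\<lambda>x. (A *v (x - c)) $ j) has_derivative (\<lambda>h. (A *v h) $ j)) (at x)"
    by (rule bounded_linear.has_derivative[OF bounded_linear_vec_nth has_derivative_matrix_vector])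
  show "partial i (partial j (quad A c s)) x = A $ i $ j"
    unfolding partial_quad[OF assms] partial_eqI[OF d]
    using symmetricD[OF assms] by (simp add: matrix_vector_mul_component inner_axis)
qed

lemma second_order_quad:
  fixes A :: "real^'n^'n"
  assumes "transpose A = A"
  shows "second_order a (quad A c s) x = trace (a ** A)"
  using symmetricD[OF assms]
  by (simp add: second_order_def second_partial_quad[OF assms] trace_def matrix_matrix_mult_def)

lemma pos_def_diagonal: "pos_def a \<Longrightarrow> a $ i $ i > 0"
proof -
  assume "pos_def a"
  then have "axis i 1 \<bullet> (a *v axis i 1) > 0" by (simp add: pos_def_def)
  then show ?thesis by (simp add: inner_axis' matrix_vector_mul_component inner_axis)
qed

lemma pos_def_trace: "pos_def a \<Longrightarrow> trace a > 0"
  unfolding trace_def by (intro sum_pos pos_def_diagonal) auto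

subsection \<open>The weak maximum principle\<close>

text \<open>Adding a small multiple of \<open>\<bar>x\<bar>\<^sup>2\<close> makes the differential inequality strict and rules out interior maxima.\<close>

theorem weak_maximum_principle:
  fixes f :: "real^'n \<Rightarrow> real"
  assumes S: "open S" "S \<noteq> {}" "bounded S" and cont: "continuous_on (closure S) f" and sm: "smooth_on S f"
    and a: "\<And>x. x \<in> S \<Longrightarrow> transpose (a x) = a x" "\<And>x. x \<in> S \<Longrightarrow> pos_def (a x)"
    and L: "\<And>x. x \<in> S \<Longrightarrow> second_order (a x) f x \<ge> 0"
  shows "\<exists>z\<in>frontier S. \<forall>x\<in>closure S. f x \<le> f z"
proof -
  have cl: "compact (closure S)" using S by (simp add: compact_closure)
  have fr: "compact (frontier S)" using S by (simp add: compact_frontier_bounded)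
  have "S \<noteq> UNIV" using S(3) not_bounded_UNIV by blast
  then have "frontier S \<noteq> {}" using S by (simp add: frontier_eq_empty)
  moreover have "continuous_on (frontier S) f"
    using cont by (rule continuous_on_subset) (simp add: frontier_def)
  ultimately obtain z where z: "z \<in> frontier S" "\<And>x. x \<in> frontier S \<Longrightarrow> f x \<le> f z"
    using continuous_attains_sup[OF fr] by blast
  have "closure S \<noteq> {}" using S by simp
  then obtain x1 where x1: "x1 \<in> closure S" "\<And>x. x \<in> closure S \<Longrightarrow> f x \<le> f x1"
    using continuous_attains_sup[OF cl _ cont] by blast
  show ?thesis
  proof (cases "f x1 \<le> f z")
    case True
    then show ?thesis using z x1 by (meson order_trans)
  next
    case False
    let ?b = "quad (mat 1) 0 0 :: real^'n \<Rightarrow> real"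
    have b0: "?b x \<ge> 0" for x by (simp add: quad_def)
    obtain xb where xb: "xb \<in> closure S" "\<And>x. x \<in> closure S \<Longrightarrow> ?b x \<le> ?b xb"
      using continuous_attains_sup[OF cl \<open>closure S \<noteq> {}\<close> continuous_quad] by metis
    define \<epsilon> where "\<epsilon> = (f x1 - f z) / (?b xb + 1)"
    have pb: "?b xb + 1 > 0" using b0[of xb] by linarith
    have \<epsilon>: "\<epsilon> > 0" using False pb by (simp add: \<epsilon>_def)
    have \<epsilon>b: "\<epsilon> * ?b xb < f x1 - f z"
    proof -
      have "\<epsilon> * ?b xb < \<epsilon> * (?b xb + 1)" using \<epsilon> by simp
      also have "\<dots> = f x1 - f z" using pb by (simp add: \<epsilon>_def)
      finally show ?thesis .
    qed
    let ?g = "\<lambda>x. f x + \<epsilon> * ?b x"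
    have "continuous_on (closure S) ?g" by (intro continuous_intros cont continuous_quad)
    then obtain x2 where x2: "x2 \<in> closure S" "\<And>x. x \<in> closure S \<Longrightarrow> ?g x \<le> ?g x2"
      using continuous_attains_sup[OF cl \<open>closure S \<noteq> {}\<close>] by blast
    have "x2 \<notin> frontier S"
    proof
      assume fr2: "x2 \<in> frontier S"
      have "?g x2 \<le> f z + \<epsilon> * ?b xb"
        using z(2)[OF fr2] xb(2)[OF x2(1)] \<epsilon> by (simp add: add_mono)
      also have "\<dots> < f x1" using \<epsilon>b by simp
      also have "\<dots> \<le> ?g x1" using b0[of x1] \<epsilon> by simp
      also have "\<dots> \<le> ?g x2" by (rule x2(2)[OF x1(1)])
      finally show False by simp
    qed
    then have x2S: "x2 \<in> S" using x2(1) S(1) by (simp add: frontier_def interior_open)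
    have smg: "smooth_on S (\<lambda>x. \<epsilon> * ?b x)" by (intro smooth_intros smooth_quad S)
    have "second_order (a x2) ?g x2 \<le> 0"
      by (rule second_order_at_max[OF S(1) smooth_add[OF S(1) sm smg] x2S])
         (use x2(2) a x2S closure_subset[of S] in blast)+
    moreover have "second_order (a x2) ?g x2 = second_order (a x2) f x2 + \<epsilon> * trace (a x2)"
      by (simp add: second_order_add[OF S(1) sm smg x2S] second_order_cmult[OF S(1) smooth_quad[OF S(1)] x2S]
          second_order_quad)
    moreover have "\<epsilon> * trace (a x2) > 0" using \<epsilon> pos_def_trace[OF a(2)[OF x2S]] by simp
    ultimately show ?thesis using L[OF x2S] by linarith
  qed
qed

subsection \<open>Hopf's strong maximum principle\<close>

text \<open>The geometric part: if the maximum set is neither empty nor everything, some closed ball meets it in exactly one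
  point.  A ball around a point outside the set that grows until it touches the set may do so at several points; the
  ball with half its radius that is internally tangent at one of them touches only there.\<close>

lemma touching_ball:
  fixes f :: "real^'n \<Rightarrow> real"
  assumes S: "open S" "connected S" and cont: "continuous_on S f"
    and x0: "x0 \<in> S" and max: "\<And>x. x \<in> S \<Longrightarrow> f x \<le> f x0"
    and other: "x1 \<in> S" "f x1 \<noteq> f x0"
  shows "\<exists>y q. q \<in> S \<and> f q = f x0 \<and> q \<noteq> y \<and>
     (\<forall>x\<in>cball y (dist y q). x \<in> S \<and> (x \<noteq> q \<longrightarrow> f x < f x0))"
proof -
  let ?M = "{x \<in> S. f x = f x0}"
  have "closedin (top_of_set S) ?M"
    by (rule continuous_closedin_preimage_constant[OF cont])
  moreover have "?M \<noteq> {}" "?M \<noteq> S" using x0 other by auto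
  ultimately have "\<not> openin (top_of_set S) ?M"
    using S(2) connected_clopen by blast
  then have "\<not> open ?M" using S(1) by (simp add: openin_open_eq)
  then obtain m where m: "m \<in> ?M" "\<And>e. e > 0 \<Longrightarrow> \<not> ball m e \<subseteq> ?M"
    unfolding open_contains_ball by blast
  then obtain r where r: "r > 0" "ball m r \<subseteq> S" using S(1) open_contains_ball by blast
  obtain p where p: "p \<in> ball m (r/2)" "p \<notin> ?M" using m(2)[OF half_gt_zero[OF r(1)]] by blast
  have sub: "cball p (dist p m) \<subseteq> S"
  proof
    fix x assume "x \<in> cball p (dist p m)"
    then have "dist m x < r" using p dist_triangle[of m x p] by (simp add: dist_commute)
    then show "x \<in> S" using r by auto
  qed
  let ?K = "{x \<in> cball p (dist p m). f x = f x0}"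
  have "closed ?K"
    by (rule continuous_closed_preimage_constant[OF continuous_on_subset[OF cont sub]]) simp
  moreover have "m \<in> ?K" using m by simp
  ultimately obtain q where q: "q \<in> ?K" "\<And>x. x \<in> ?K \<Longrightarrow> dist p q \<le> dist p x"
    using distance_attains_inf[of ?K p] by blast
  have less: "f x < f x0" if "dist p x < dist p q" for x
  proof -
    have "x \<in> cball p (dist p m)" using that q by auto
    moreover from this have "f x \<noteq> f x0" using q(2)[of x] that by auto
    ultimately show ?thesis using max sub by fastforce
  qed
  have qM: "q \<in> ?M" using q(1) sub by blast
  then have pq: "p \<noteq> q" using p(2) by blast
  define y where "y = (1/2) *\<^sub>R (p + q)"
  define w where "w = (1/2) *\<^sub>R (q - p)"
  have q_eq: "q = y + w" and p_eq: "p = y - w"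
    by (simp_all add: y_def w_def scaleR_right_distrib scaleR_right_diff_distrib flip: scaleR_left_distrib)
  have dpq: "dist p q = 2 * norm w" unfolding w_def by (simp add: dist_norm norm_minus_commute)
  have x: "x \<in> S \<and> (x \<noteq> q \<longrightarrow> f x < f x0)" if "x \<in> cball y (dist y q)" for x
  proof -
    define z where "z = x - y"
    have z: "norm z \<le> norm w" using that by (simp add: z_def q_eq dist_norm norm_minus_commute)
    have px: "dist p x = norm (z + w)"
      by (simp add: p_eq z_def dist_norm norm_minus_commute algebra_simps)
    \<comment> \<open>By the parallelogram law a point of the half-size ball at full distance from \<open>p\<close> is \<open>q\<close>.\<close>
    have "(norm (z + w))\<^sup>2 + (norm (z - w))\<^sup>2 = 2 * (norm z)\<^sup>2 + 2 * (norm w)\<^sup>2"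
      by (simp add: power2_norm_eq_inner inner_add_left inner_add_right inner_diff_left inner_diff_right inner_commute)
    also have "\<dots> \<le> (dist p q)\<^sup>2"
      using power_mono[OF z, of 2] by (simp add: dpq power_mult_distrib)
    finally have par: "(dist p x)\<^sup>2 + (norm (z - w))\<^sup>2 \<le> (dist p q)\<^sup>2" unfolding px .
    then have "(dist p x)\<^sup>2 \<le> (dist p q)\<^sup>2" by (smt (verit) zero_le_power2)
    then have "dist p x \<le> dist p q" by (rule power2_le_imp_le) simp
    then have "x \<in> S" using sub q by auto
    moreover have "f x < f x0" if "x \<noteq> q"
    proof (rule less, rule power2_less_imp_less)
      have "z \<noteq> w" using that by (auto simp: z_def q_eq)
      then show "(dist p x)\<^sup>2 < (dist p q)\<^sup>2" using par by (smt (verit) right_minus_eq zero_less_norm_iff zero_less_power)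
    qed simp
    ultimately show ?thesis by simp
  qed
  have "q \<noteq> y" using pq by (auto simp: q_eq p_eq)
  moreover have "q \<in> S" "f q = f x0" using qM by auto
  ultimately show ?thesis using x by blast
qed

text \<open>The analytic part: with \<open>Q = (\<bar>x - y\<bar>\<^sup>2 - R\<^sup>2) / 2\<close> for the touching ball, the barrier \<open>w = K Q\<^sup>2 - Q\<close> vanishes
  at the touching point \<open>q\<close>, is negative outside the ball near \<open>q\<close>, and for large \<open>K\<close> is a strict
  subsolution near \<open>q\<close>.  Hence \<open>f + \<epsilon> w\<close> has an interior maximum in a small ball around \<open>q\<close>, where it is a strict
  subsolution.\<close>

theorem strong_maximum_principle:
  fixes f :: "real^'n \<Rightarrow> real"
  assumes S: "open S" "connected S" and sm: "smooth_on S f"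
    and a: "\<And>x. x \<in> S \<Longrightarrow> transpose (a x) = a x" "\<And>x. x \<in> S \<Longrightarrow> pos_def (a x)"
      "\<And>i j. continuous_on S (\<lambda>x. a x $ i $ j)"
    and L: "\<And>x. x \<in> S \<Longrightarrow> second_order (a x) f x \<ge> 0"
    and x0: "x0 \<in> S" and max: "\<And>x. x \<in> S \<Longrightarrow> f x \<le> f x0" and x1: "x1 \<in> S"
  shows "f x1 = f x0"
proof (rule ccontr)
  assume "f x1 \<noteq> f x0"
  then obtain y q where q: "q \<in> S" "f q = f x0" "q \<noteq> y"
    and touch: "\<And>x. x \<in> cball y (dist y q) \<Longrightarrow> x \<noteq> q \<Longrightarrow> f x < f x0"
    using touching_ball[OF S smooth_continuous[OF sm] x0 max x1] by blast
  define R where "R = dist y q"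
  let ?Q = "quad (mat 1) y (R\<^sup>2 / 2) :: real^'n \<Rightarrow> real"
  have Qx: "?Q x = ((dist y x)\<^sup>2 - R\<^sup>2) / 2" for x
    by (simp add: quad_def dist_norm power2_norm_eq_inner norm_minus_commute[of y] field_simps)
  have Qq: "?Q q = 0" unfolding Qx by (simp add: R_def)
  define \<kappa> where "\<kappa> = (q - y) \<bullet> (a q *v (q - y))"
  have \<kappa>: "\<kappa> > 0" using a(2)[OF q(1)] q(3) by (simp add: \<kappa>_def pos_def_def)
  define K where "K = trace (a q) / \<kappa>"
  have tr: "trace (a x) > 0" if "x \<in> S" for x using pos_def_trace a(2)[OF that] .
  let ?w = "\<lambda>x. K * (?Q x * ?Q x) - ?Q x"
  have smQ: "smooth_on S ?Q" by (rule smooth_quad[OF S(1)])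
  have smw: "smooth_on S ?w" by (intro smooth_intros smQ S(1))
  have "second_order (a q) ?w q = K * second_order (a q) (\<lambda>x. ?Q x * ?Q x) q - trace (a q)"
    using second_order_diff[OF S(1) smooth_mult[OF S(1) smooth_const[of S K] smooth_mult[OF S(1) smQ smQ]] smQ q(1)]
    by (simp add: second_order_cmult[OF S(1) smooth_mult[OF S(1) smQ smQ] q(1)] second_order_quad)
  also have "second_order (a q) (\<lambda>x. ?Q x * ?Q x) q = 2 * \<kappa>"
    by (subst second_order_mult[OF S(1) smQ smQ q(1) a(1)[OF q(1)]])
       (simp add: Qq partial_quad \<kappa>_def quadratic_form_sum mult_ac)
  also have "K * (2 * \<kappa>) - trace (a q) = trace (a q)" using \<kappa> by (simp add: K_def)
  finally have Lwq: "second_order (a q) ?w q > 0" using tr[OF q(1)] by simp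
  have "continuous_on S (\<lambda>x. second_order (a x) ?w x)"
    unfolding second_order_def
    by (intro continuous_intros a(3) smooth_continuous smooth_partial smw)
  then have "open {x \<in> S. second_order (a x) ?w x > 0}"
    using S(1) continuous_open_preimage[of S "\<lambda>x. second_order (a x) ?w x" "{0<..}"]
    by (simp add: vimage_def Int_def)
  moreover have "open {x. \<bar>K * ?Q x\<bar> < 1}"
    by (intro open_Collect_less continuous_intros continuous_quad)
  ultimately have "open ({x \<in> S. second_order (a x) ?w x > 0} \<inter> {x. \<bar>K * ?Q x\<bar> < 1})" by blast
  moreover have "q \<in> {x \<in> S. second_order (a x) ?w x > 0} \<inter> {x. \<bar>K * ?Q x\<bar> < 1}"
    using Lwq q(1) Qq by simp
  ultimately obtain \<delta> where \<delta>: "\<delta> > 0" "cball q \<delta> \<subseteq> {x \<in> S. second_order (a x) ?w x > 0} \<inter> {x. \<bar>K * ?Q x\<bar> < 1}"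
    unfolding open_contains_cball by blast
  have near: "x \<in> S" "second_order (a x) ?w x > 0" "\<bar>K * ?Q x\<bar> < 1" if "x \<in> cball q \<delta>" for x
    using \<delta>(2) that by auto
  let ?C = "sphere q \<delta> \<inter> cball y R"
  have subC: "?C \<subseteq> cball q \<delta>" by auto
  have contf: "continuous_on (cball q \<delta>) f" and contw: "continuous_on (cball q \<delta>) ?w"
    using near(1) by (auto intro!: continuous_on_subset[OF smooth_continuous[OF sm]]
        continuous_on_subset[OF smooth_continuous[OF smw]])
  have "\<exists>\<epsilon>>0. \<forall>x\<in>?C. f x + \<epsilon> * ?w x < f x0"
  proof (cases "?C = {}")
    case False
    have comp: "compact ?C" by (simp add: compact_Int)
    obtain c where c: "c \<in> ?C" "\<And>x. x \<in> ?C \<Longrightarrow> f x \<le> f c"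
      using continuous_attains_sup[OF comp False continuous_on_subset[OF contf subC]] by blast
    obtain d where d: "d \<in> ?C" "\<And>x. x \<in> ?C \<Longrightarrow> ?w x \<le> ?w d"
      using continuous_attains_sup[OF comp False continuous_on_subset[OF contw subC]] by blast
    have gap: "f x0 - f c > 0" using touch[of c] c(1) \<delta>(1) by (auto simp: R_def)
    define \<epsilon> where "\<epsilon> = (f x0 - f c) / (\<bar>?w d\<bar> + 1)"
    have \<epsilon>: "\<epsilon> > 0" using gap by (simp add: \<epsilon>_def)
    have "f x + \<epsilon> * ?w x < f x0" if "x \<in> ?C" for x
    proof -
      have "\<epsilon> * ?w x \<le> \<epsilon> * \<bar>?w d\<bar>" using d(2)[OF that] \<epsilon> by (intro mult_left_mono) auto
      also have "\<dots> < \<epsilon> * (\<bar>?w d\<bar> + 1)" using \<epsilon> by simp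
      also have "\<dots> = f x0 - f c" by (simp add: \<epsilon>_def)
      finally show ?thesis using c(2)[OF that] by linarith
    qed
    then show ?thesis using \<epsilon> by blast
  qed (auto intro: exI[of _ 1])
  then obtain \<epsilon> where \<epsilon>: "\<epsilon> > 0" "\<And>x. x \<in> ?C \<Longrightarrow> f x + \<epsilon> * ?w x < f x0" by blast
  let ?g = "\<lambda>x. f x + \<epsilon> * ?w x"
  have sphere: "?g x < f x0" if "x \<in> sphere q \<delta>" for x
  proof (cases "x \<in> cball y R")
    case False
    then have "R < dist y x" by simp
    then have "R\<^sup>2 < (dist y x)\<^sup>2" by (intro power_strict_mono) (auto simp: R_def)
    then have Qp: "?Q x > 0" by (simp add: Qx)
    have xb: "x \<in> cball q \<delta>" using that by auto
    have "?w x = - (?Q x * (1 - K * ?Q x))" by (simp add: algebra_simps)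
    then have "?w x < 0" using Qp near(3)[OF xb] by (simp add: mult_pos_pos abs_less_iff)
    then have "\<epsilon> * ?w x < 0" using \<epsilon>(1) by (simp add: mult_pos_neg)
    then show ?thesis using max[OF near(1)[OF xb]] by linarith
  qed (use \<epsilon>(2) that in auto)
  have "continuous_on (cball q \<delta>) ?g" by (intro continuous_on_add contf continuous_on_mult_left contw)
  then obtain z where z: "z \<in> cball q \<delta>" "\<And>x. x \<in> cball q \<delta> \<Longrightarrow> ?g x \<le> ?g z"
    using continuous_attains_sup[OF compact_cball, of q \<delta> ?g] \<delta>(1) by auto
  have "?g q = f x0" using q(2) Qq by simp
  then have "f x0 \<le> ?g z" using z(2)[of q] \<delta>(1) by simp
  then have zb: "z \<in> ball q \<delta>" using z(1) sphere[of z] by (auto simp: less_le)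
  have zS: "z \<in> S" using near(1) z(1) .
  have smg: "smooth_on S (\<lambda>x. \<epsilon> * ?w x)" by (intro smooth_mult smooth_const S(1) smw)
  have "second_order (a z) ?g z \<le> 0"
  proof (rule second_order_at_max[OF open_ball _ zb])
    show "smooth_on (ball q \<delta>) ?g"
      by (rule smooth_subset[OF smooth_add[OF S(1) sm smg]]) (use near(1) in auto)
  qed (use z(2) a zS in auto)
  moreover have "second_order (a z) ?g z = second_order (a z) f z + \<epsilon> * second_order (a z) ?w z"
    by (simp add: second_order_add[OF S(1) sm smg zS] second_order_cmult[OF S(1) smw zS])
  moreover have "\<epsilon> * second_order (a z) ?w z > 0" using near(2)[OF z(1)] \<epsilon>(1) by simp
  ultimately show False using L[OF zS] by linarith
qed

section \<open>The Hessian and values on the closure\<close>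

definition hess :: "(real^'n \<Rightarrow> real) \<Rightarrow> real^'n \<Rightarrow> real^'n^'n" where
  "hess u x = (\<chi> i j. partial i (partial j u) x)"

lemma hess_symmetric:
  assumes "open S" "smooth_on S u" "x \<in> S"
  shows "transpose (hess u x) = hess u x"
  by (rule symmetricI) (simp add: hess_def partial_commute[OF assms])

lemma second_order_hess:
  assumes "open S" "smooth_on S u" "x \<in> S"
  shows "second_order a u x = trace (a ** hess u x)"
  by (simp add: second_order_def trace_def matrix_matrix_mult_def hess_def partial_commute[OF assms])

lemma hessian_interior: "x \<in> S \<Longrightarrow> hessian S u x = hess u x"
  by (simp add: hessian_def hess_def closure_ext_def partials_Cons partials_Nil vec_eq_iff)

lemma grad_interior: "x \<in> S \<Longrightarrow> grad S u x $ k = partial k u x"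
  by (simp add: grad_def closure_ext_def partials_Cons partials_Nil)

lemma closure_ext_eq:
  fixes f :: "real^'n \<Rightarrow> real"
  assumes g: "continuous_on (closure S) g" "\<And>x. x \<in> S \<Longrightarrow> g x = f x" and x: "x \<in> closure S"
  shows "closure_ext S f x = g x"
proof (cases "x \<in> S")
  case False
  then have lim: "x islimpt S" using x by (simp add: closure_def)
  have "(g \<longlongrightarrow> g x) (at x within S)"
    using g(1) x closure_subset by (metis continuous_on_def tendsto_within_subset)
  then have "(f \<longlongrightarrow> g x) (at x within S)"
    by (rule Lim_transform_eventually) (use g(2) in \<open>auto simp: eventually_at_filter\<close>)
  then have "Lim (at x within S) f = g x"
    using lim trivial_limit_within by (blast intro: tendsto_Lim)
  then show ?thesis using False by (simp add: closure_ext_def)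
qed (simp add: closure_ext_def g(2))

lemma continuous_closure_ext:
  assumes "C2_on_closure S f" "length ks \<in> {1, 2}"
  shows "continuous_on (closure S) (closure_ext S (partials ks f))"
proof -
  obtain g where g: "continuous_on (closure S) g" "\<And>x. x \<in> S \<Longrightarrow> g x = partials ks f x"
    using assms unfolding C2_on_closure_def by blast
  have "closure_ext S (partials ks f) x = g x" if "x \<in> closure S" for x
    by (rule closure_ext_eq[OF g that])
  then show ?thesis using g(1) by (subst continuous_on_cong[OF refl, where g = g])
qed

lemma continuous_psi:
  fixes u :: "real^'n \<Rightarrow> real"
  assumes "C2_on_closure S u"
  shows "continuous_on (closure S) (psi S u)"
proof -
  have g: "continuous_on (closure S) (\<lambda>x. grad S u x $ k)" for k
    using continuous_closure_ext[OF assms, of "[k]"] by (simp add: grad_def)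
  have h: "continuous_on (closure S) (\<lambda>x. hessian S u x $ k $ l)" for k l
    using continuous_closure_ext[OF assms, of "[k, l]"] by (simp add: hessian_def)
  have "continuous_on (closure S) (\<lambda>x. dsigma2 (hessian S u x) k l)" for k l
    by (cases "k = l") (auto simp: dsigma2_eq trace_def intro!: continuous_intros h)
  moreover have "continuous_on (closure S) u" using assms by (simp add: C2_on_closure_def)
  ultimately show ?thesis
    unfolding psi_def[abs_def] by (intro continuous_intros g)
qed

section \<open>The differential inequality\<close>

lemma partial_commute3:
  fixes f :: "real^'n \<Rightarrow> real"
  assumes S: "open S" "smooth_on S f" "x \<in> S"
  shows "partial k (partial i (partial j f)) x = partial i (partial j (partial k f)) x"
proof -
  have "partial k (partial i (partial j f)) x = partial i (partial k (partial j f)) x"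
    by (rule partial_commute[OF S(1) smooth_partial[OF S(2)] S(3)])
  also have "\<dots> = partial i (partial j (partial k f)) x"
    by (rule partial_cong[OF S(1,3)]) (rule partial_commute[OF S(1,2)])
  finally show ?thesis .
qed

lemma smooth_second_order:
  "open S \<Longrightarrow> smooth_on S f \<Longrightarrow> smooth_on S (second_order a f)"
  unfolding second_order_def[abs_def] by (intro smooth_intros)

text \<open>The coefficient matrix \<open>a\<close> is constant here.  In the applications it is frozen at one point, so that
  differentiating \<open>tr (a D\<^sup>2f)\<close> commutes with the operator.\<close>

lemma partial_second_order:
  fixes f :: "real^'n \<Rightarrow> real"
  assumes S: "open S" "smooth_on S f" "x \<in> S"
  shows "partial k (second_order a f) x = second_order a (partial k f) x"
proof -
  have d: "(\<lambda>x. a $ i $ j * partial i (partial j f) x) differentiable (at x)" for i j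
    by (intro smooth_differentiable[OF _ S(3)] smooth_intros S)
  have ds: "(\<lambda>x. \<Sum>j\<in>UNIV. a $ i $ j * partial i (partial j f) x) differentiable (at x)" for i
    by (intro smooth_differentiable[OF _ S(3)] smooth_intros S)
  have "partial k (second_order a f) x = (\<Sum>i\<in>UNIV. \<Sum>j\<in>UNIV. partial k (\<lambda>x. a $ i $ j * partial i (partial j f) x) x)"
    unfolding second_order_def[abs_def]
    by (subst partial_sum, rule ds, intro sum.cong refl partial_sum d)
  then show ?thesis
    by (simp add: second_order_def partial_commute3[OF S, symmetric]
        partial_cmult[OF smooth_differentiable[OF smooth_partial[OF smooth_partial[OF S(2)]] S(3)]])
qed

text \<open>The matrix \<open>\<partial>\<sigma>\<^sub>2 / \<partial>u\<^sub>k\<^sub>l\<close> at the Hessian is its first Newton transformation \<open>\<Delta>u I - D\<^sup>2u\<close>.  In terms of it,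
  \<open>p_function\<close> is \<open>\<psi>\<close> inside the domain, with plain partial derivatives in place of their extensions to the closure.\<close>

definition newton :: "(real^'n \<Rightarrow> real) \<Rightarrow> 'n \<Rightarrow> 'n \<Rightarrow> real^'n \<Rightarrow> real" where
  "newton u k l x = (if k = l then \<Sum>m\<in>UNIV. partial m (partial m u) x else 0) - partial l (partial k u) x"

definition p_function :: "(real^'n \<Rightarrow> real) \<Rightarrow> real^'n \<Rightarrow> real" where
  "p_function u x = (\<Sum>k\<in>UNIV. \<Sum>l\<in>UNIV. newton u k l x * (partial k u x * partial l u x))
     - 2 * (real CARD('n) - 1) * u x"

lemma psi_interior: "x \<in> S \<Longrightarrow> psi S u x = p_function u x"
  by (simp add: psi_def p_function_def newton_def dsigma2_eq hessian_interior grad_interior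
      hess_def trace_def mult.assoc cong: if_cong)

lemma smooth_newton:
  assumes "open S" "smooth_on S u"
  shows "smooth_on S (newton u k l)"
proof -
  have "smooth_on S (\<lambda>x. if k = l then \<Sum>m\<in>UNIV. partial m (partial m u) x else 0)"
    using assms by (cases "k = l") (auto intro!: smooth_intros)
  then show ?thesis
    unfolding newton_def[abs_def] by (intro smooth_intros assms)
qed

lemma smooth_p_function:
  assumes "open S" "smooth_on S u"
  shows "smooth_on S (p_function u)"
  unfolding p_function_def[abs_def] by (intro smooth_intros smooth_newton assms)

text \<open>Third derivatives are symmetric, so the divergence is the difference of two equal sums.\<close>

lemma newton_divergence_free:
  fixes u :: "real^'n \<Rightarrow> real"
  assumes S: "open S" "smooth_on S u" "x \<in> S"
  shows "(\<Sum>l\<in>UNIV. partial l (newton u k l) x) = 0" "(\<Sum>l\<in>UNIV. partial l (newton u l k) x) = 0"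
proof -
  have p: "partial l (newton u k l) x = (if k = l then \<Sum>m\<in>UNIV. partial l (partial m (partial m u)) x else 0)
      - partial l (partial l (partial k u)) x" for k l
  proof -
    have d: "partial m (partial j u) differentiable (at x)" for m j
      by (intro smooth_differentiable[OF _ S(3)] smooth_intros S)
    have ds: "(\<lambda>x. \<Sum>m\<in>UNIV. partial m (partial m u) x) differentiable (at x)"
      by (intro smooth_differentiable[OF _ S(3)] smooth_intros S)
    have "partial l (\<lambda>x. - partial l (partial k u) x) x = - partial l (partial l (partial k u)) x"
      using partial_cmult[OF d, of l "-1" l k] by simp
    then show ?thesis
      unfolding newton_def[abs_def]
      by (cases "k = l") (simp_all add: partial_diff d ds partial_sum partial_const)
  qed
  have "(\<Sum>l\<in>UNIV. partial l (newton u k l) x) =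
      (\<Sum>m\<in>UNIV. partial k (partial m (partial m u)) x) - (\<Sum>l\<in>UNIV. partial l (partial l (partial k u)) x)" for k
    unfolding p by (simp add: sum_subtractf)
  then show 1: "(\<Sum>l\<in>UNIV. partial l (newton u k l) x) = 0" for k
    by (simp add: partial_commute3[OF S])
  have "newton u l k y = newton u k l y" if "y \<in> S" for y l
    using partial_commute[OF S(1,2) that] by (auto simp: newton_def)
  then have "partial l (newton u l k) x = partial l (newton u k l) x" for l
    by (intro partial_cong[OF S(1,3)])
  then show "(\<Sum>l\<in>UNIV. partial l (newton u l k) x) = 0" using 1[of k] by simp
qed

locale monge_ampere =
  fixes \<Omega> :: "(real^'n) set" and u :: "real^'n \<Rightarrow> real"
  assumes open_domain: "open \<Omega>" and smooth: "smooth_on \<Omega> u"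
    and pos: "\<And>x. x \<in> \<Omega> \<Longrightarrow> pos_def (hess u x)" and det1: "\<And>x. x \<in> \<Omega> \<Longrightarrow> det (hess u x) = 1"
begin

lemmas sym = hess_symmetric[OF open_domain smooth]

abbreviation coef :: "real^'n \<Rightarrow> real^'n^'n" where
  "coef x \<equiv> matrix_inv (hess u x)"

lemma coef:
  assumes "x \<in> \<Omega>"
  shows "hess u x ** coef x = mat 1" "coef x ** hess u x = mat 1" "transpose (coef x) = coef x"
    "pos_def (coef x)" "det (coef x) = 1"
  using pos_def_inverse[OF sym[OF assms] pos[OF assms] det1[OF assms]] by blast+

lemma coef_symmetric: "x \<in> \<Omega> \<Longrightarrow> transpose (coef x) = coef x" by (rule coef)

lemma continuous_coef: "continuous_on \<Omega> (\<lambda>x. coef x $ i $ j)"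
proof (rule continuous_on_matrix_inv)
  show "continuous_on \<Omega> (\<lambda>x. hess u x $ i $ j)" for i j
    by (simp add: hess_def smooth_continuous smooth_partial smooth)
qed (rule det1)

lemma second_order_solution: "x \<in> \<Omega> \<Longrightarrow> second_order (coef x) u x = CARD('n)"
  by (simp add: second_order_hess[OF open_domain smooth] coef(2) trace_I)

text \<open>By the inequality between arithmetic and geometric means \<open>y \<mapsto> tr ((D\<^sup>2u x)\<inverse> D\<^sup>2u y)\<close> has a minimum at
  \<open>y = x\<close>.  Its vanishing gradient there is the differentiated equation, and its nonnegative Hessian is what
  remains of the twice differentiated equation.\<close>

lemma differentiated_equation:
  assumes x: "x \<in> \<Omega>"
  shows "second_order (coef x) (partial k u) x = 0"
    and "(\<Sum>k\<in>UNIV. \<Sum>l\<in>UNIV. v $ k * v $ l * second_order (coef x) (partial k (partial l u)) x) \<ge> 0"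
proof -
  let ?F = "second_order (coef x) u"
  have smF: "smooth_on \<Omega> ?F" by (rule smooth_second_order[OF open_domain smooth])
  have smF': "smooth_on \<Omega> (\<lambda>y. - 1 * ?F y)" by (intro smooth_intros smF open_domain)
  have "?F x \<le> ?F y" if "y \<in> \<Omega>" for y
    using trace_mult_ge_card[OF coef(3-5)[OF x] sym[OF that] pos[OF that] det1[OF that]]
    by (simp add: second_order_solution[OF x] second_order_hess[OF open_domain smooth that])
  then have max: "- 1 * ?F y \<le> - 1 * ?F x" if "y \<in> \<Omega>" for y using that by simp
  have "partial k (\<lambda>y. - 1 * ?F y) x = 0"
    by (rule interior_max_derivatives(1)[OF open_domain smF' x max])
  then show "second_order (coef x) (partial k u) x = 0"
    by (simp only: partial_cmult[OF smooth_differentiable[OF smF x]]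
        partial_second_order[OF open_domain smooth x])
  have "partial k (partial l ?F) x = second_order (coef x) (partial k (partial l u)) x" for k l
  proof -
    have "partial k (partial l ?F) x = partial k (second_order (coef x) (partial l u)) x"
      by (rule partial_cong[OF open_domain x]) (rule partial_second_order[OF open_domain smooth])
    then show ?thesis by (simp add: partial_second_order[OF open_domain smooth_partial[OF smooth] x])
  qed
  moreover have "partial k (partial l (\<lambda>y. - 1 * ?F y)) x = - partial k (partial l ?F) x" for k l
    unfolding second_partial_mult[OF open_domain smooth_const smF x] by (simp add: partial_const)
  ultimately show "(\<Sum>k\<in>UNIV. \<Sum>l\<in>UNIV. v $ k * v $ l * second_order (coef x) (partial k (partial l u)) x) \<ge> 0"
    using interior_max_derivatives(2)[OF open_domain smF' x max, of v] by (simp add: sum_negf)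
qed

lemma coef_gradient:
  assumes x: "x \<in> \<Omega>"
  shows "(\<Sum>i\<in>UNIV. \<Sum>j\<in>UNIV. coef x $ i $ j * (f i * partial j (partial k u) x)) = f k"
proof -
  have eq: "(\<Sum>j\<in>UNIV. coef x $ i $ j * (f i * partial j (partial k u) x)) = f i * (coef x ** hess u x) $ i $ k" for i
    by (simp add: matrix_matrix_mult_def hess_def sum_distrib_left mult_ac)
  have "f i * (coef x ** hess u x) $ i $ k = (if i = k then f i else 0)" for i
    by (simp add: coef(2)[OF x] mat_def)
  then show ?thesis unfolding eq by simp
qed

text \<open>The product rule for \<open>L = tr ((D\<^sup>2u)\<inverse> D\<^sup>2)\<close> applied to \<open>T\<^sub>k\<^sub>l u\<^sub>k u\<^sub>l\<close>, where \<open>T\<close> is the Newton transformation: the terms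
  with \<open>L u\<^sub>k\<close> vanish by the differentiated equation.  In the cross terms the inverse Hessian cancels the Hessian
  that comes from differentiating \<open>u\<^sub>k\<close>; what is left there is a divergence of \<open>T\<close>, which vanishes, and the
  contraction of \<open>T\<close> with \<open>D\<^sup>2u\<close>, which is \<open>2\<sigma>\<^sub>2\<close>.\<close>

lemma second_order_p_function:
  assumes x: "x \<in> \<Omega>"
  defines "Q \<equiv> (\<chi> k l. second_order (coef x) (partial k (partial l u)) x) :: real^'n^'n"
    and "p \<equiv> (\<chi> k. partial k u x) :: real^'n" and "H \<equiv> hess u x"
  shows "second_order (coef x) (p_function u) x
     = (trace Q * (p \<bullet> p) - p \<bullet> (Q *v p)) + 2 * ((trace H)\<^sup>2 - trace (H ** H) - CARD('n) * (real CARD('n) - 1))"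
proof -
  let ?L = "second_order (coef x)"
  let ?N = "newton u"
  note S = open_domain
  note d = smooth_differentiable[OF _ x]
  have smp: "smooth_on \<Omega> (partial k u)" for k by (rule smooth_partial[OF smooth])
  have smN: "smooth_on \<Omega> (?N k l)" for k l by (rule smooth_newton[OF S smooth])
  have smpp: "smooth_on \<Omega> (\<lambda>y. partial k u y * partial l u y)" for k l by (intro smooth_intros S smooth)
  have smt: "smooth_on \<Omega> (\<lambda>y. ?N k l y * (partial k u y * partial l u y))" for k l
    by (intro smooth_intros S smooth smN)
  have Lpp: "?L (\<lambda>y. partial k u y * partial l u y) x = 2 * hess u x $ l $ k" for k l
    unfolding second_order_mult[OF S smp smp x coef_symmetric[OF x]] differentiated_equation(1)[OF x] coef_gradient[OF x]
    by (simp add: hess_def partial_commute[OF S smooth x])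
  have cross: "(\<Sum>i\<in>UNIV. \<Sum>j\<in>UNIV. coef x $ i $ j * (partial i f x * partial j (\<lambda>y. partial k u y * partial l u y) x))
      = p $ k * partial l f x + p $ l * partial k f x" for f k l
  proof -
    have "coef x $ i $ j * (partial i f x * partial j (\<lambda>y. partial k u y * partial l u y) x) =
       p $ k * (coef x $ i $ j * (partial i f x * partial j (partial l u) x)) +
       p $ l * (coef x $ i $ j * (partial i f x * partial j (partial k u) x))" for i j
      unfolding partial_mult[OF d[OF smp] d[OF smp]] by (simp add: p_def algebra_simps)
    then show ?thesis
      by (simp only: sum.distrib sum_distrib_left[symmetric] coef_gradient[OF x])
  qed
  have LN: "?L (?N k l) x = (if k = l then trace Q else 0) - Q $ l $ k" for k l
  proof -
    have sm2: "smooth_on \<Omega> (partial i (partial j u))" for i j by (intro smooth_intros smooth)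
    have sms: "smooth_on \<Omega> (\<lambda>y. \<Sum>m\<in>UNIV. partial m (partial m u) y)" by (intro smooth_intros S smooth)
    have "?L (\<lambda>y. - partial l (partial k u) y) x = - ?L (partial l (partial k u)) x"
      using second_order_cmult[OF S sm2 x, of "coef x" "-1" l k] by simp
    then show ?thesis
      unfolding newton_def[abs_def]
      by (cases "k = l") (simp_all add: second_order_diff[OF S _ sm2 x] sms smooth_const second_order_const[OF S]
        second_order_sum[OF S sm2 x] Q_def trace_def)
  qed
  have Lt: "?L (\<lambda>y. ?N k l y * (partial k u y * partial l u y)) x =
      2 * (?N k l x * H $ l $ k) + p $ k * p $ l * ((if k = l then trace Q else 0) - Q $ l $ k)
      + 2 * (p $ k * partial l (?N k l) x) + 2 * (p $ l * partial k (?N k l) x)" for k l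
    unfolding second_order_mult[OF S smN smpp x coef_symmetric[OF x]] Lpp cross LN
    by (simp add: p_def H_def algebra_simps)
  have "?L (p_function u) x = (\<Sum>k\<in>UNIV. \<Sum>l\<in>UNIV. ?L (\<lambda>y. ?N k l y * (partial k u y * partial l u y)) x)
      - 2 * (real CARD('n) - 1) * CARD('n)"
    unfolding p_function_def[abs_def]
    by (subst second_order_diff[OF S _ _ x])
       (auto intro!: smooth_intros S smooth smN
         simp: second_order_sum[OF S _ x] smt smooth_sum[OF S] second_order_cmult[OF S smooth x]
           second_order_solution[OF x])
  also have "(\<Sum>k\<in>UNIV. \<Sum>l\<in>UNIV. ?L (\<lambda>y. ?N k l y * (partial k u y * partial l u y)) x)
     = 2 * (\<Sum>k\<in>UNIV. \<Sum>l\<in>UNIV. ?N k l x * H $ l $ k)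
       + (\<Sum>k\<in>UNIV. \<Sum>l\<in>UNIV. p $ k * p $ l * ((if k = l then trace Q else 0) - Q $ l $ k))
       + 2 * (\<Sum>k\<in>UNIV. p $ k * (\<Sum>l\<in>UNIV. partial l (?N k l) x))
       + 2 * (\<Sum>k\<in>UNIV. \<Sum>l\<in>UNIV. p $ l * partial k (?N k l) x)"
    unfolding Lt by (simp only: sum.distrib sum_distrib_left)
  also have "(\<Sum>k\<in>UNIV. \<Sum>l\<in>UNIV. p $ l * partial k (?N k l) x) = (\<Sum>l\<in>UNIV. p $ l * (\<Sum>k\<in>UNIV. partial k (?N k l) x))"
    unfolding sum_distrib_left by (rule sum.swap)
  also have "(\<Sum>k\<in>UNIV. \<Sum>l\<in>UNIV. p $ k * p $ l * ((if k = l then trace Q else 0) - Q $ l $ k))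
     = trace Q * (p \<bullet> p) - p \<bullet> (Q *v p)"
  proof -
    have "(\<Sum>k\<in>UNIV. \<Sum>l\<in>UNIV. p $ k * p $ l * Q $ l $ k) = p \<bullet> (Q *v p)"
      unfolding quadratic_form_sum by (subst sum.swap) (simp add: mult_ac)
    moreover have "(\<Sum>k\<in>UNIV. \<Sum>l\<in>UNIV. p $ k * p $ l * (if k = l then trace Q else 0)) = trace Q * (p \<bullet> p)"
      by (simp add: inner_vec_def if_distrib sum_distrib_left mult_ac cong: if_cong)
    ultimately show ?thesis by (simp add: right_diff_distrib sum_subtractf)
  qed
  also have "(\<Sum>k\<in>UNIV. \<Sum>l\<in>UNIV. ?N k l x * H $ l $ k) = (trace H)\<^sup>2 - trace (H ** H)"
  proof -
    have "?N k l x * H $ l $ k = (if k = l then trace H * H $ l $ k else 0) - H $ k $ l * H $ l $ k" for k l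
      using partial_commute[OF S smooth x, of k l]
      by (auto simp: newton_def H_def hess_def trace_def algebra_simps)
    then show ?thesis
      by (simp add: sum_subtractf power2_eq_square flip: sum_distrib_left)
         (simp add: trace_def matrix_matrix_mult_def)
  qed
  finally show ?thesis
    by (simp add: newton_divergence_free[OF S smooth x] algebra_simps)
qed

text \<open>Both brackets in the formula for \<open>L \<psi>\<close> are nonnegative; the second one is Maclaurin's inequality, whose case of
  equality determines the Hessian in dimension at least three.\<close>

lemma second_order_p_function_bounds:
  assumes x: "x \<in> \<Omega>"
  shows "second_order (coef x) (p_function u) x \<ge> 0"
    and "second_order (coef x) (p_function u) x = 0 \<Longrightarrow> CARD('n) \<ge> 3 \<Longrightarrow> hess u x = mat 1"
proof -
  define Q :: "real^'n^'n" where "Q = (\<chi> k l. second_order (coef x) (partial k (partial l u)) x)"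
  define p :: "real^'n" where "p = (\<chi> k. partial k u x)"
  define m where "m = (trace (hess u x))\<^sup>2 - trace (hess u x ** hess u x) - CARD('n) * (real CARD('n) - 1)"
  have "second_order (coef x) (partial k (partial l u)) x = second_order (coef x) (partial l (partial k u)) x" for k l
    by (rule second_order_cong[OF open_domain x]) (rule partial_commute[OF open_domain smooth])
  then have "transpose Q = Q" by (intro symmetricI) (simp add: Q_def)
  moreover have "v \<bullet> (Q *v v) \<ge> 0" for v
    using differentiated_equation(2)[OF x, of v] by (simp add: quadratic_form_sum Q_def)
  ultimately have "p \<bullet> (Q *v p) \<le> trace Q * (p \<bullet> p)" by (rule psd_form_le_trace)
  moreover have m0: "m \<ge> 0"
    using maclaurin_second(1)[OF sym[OF x] pos[OF x] det1[OF x]] by (simp add: m_def)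
  moreover have eq: "second_order (coef x) (p_function u) x = (trace Q * (p \<bullet> p) - p \<bullet> (Q *v p)) + 2 * m"
    unfolding m_def Q_def p_def by (rule second_order_p_function[OF x])
  ultimately show "second_order (coef x) (p_function u) x \<ge> 0" by linarith
  assume "second_order (coef x) (p_function u) x = 0" and n: "CARD('n) \<ge> 3"
  then have "m = 0" using eq m0 \<open>p \<bullet> (Q *v p) \<le> trace Q * (p \<bullet> p)\<close> by linarith
  then show "hess u x = mat 1"
    by (intro maclaurin_second(2)[OF sym[OF x] pos[OF x] det1[OF x] _ n]) (simp add: m_def)
qed

lemma p_function_constant_if_interior_max:
  assumes "connected \<Omega>" "x0 \<in> \<Omega>" "\<And>x. x \<in> \<Omega> \<Longrightarrow> p_function u x \<le> p_function u x0" "x \<in> \<Omega>"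
  shows "p_function u x = p_function u x0"
  by (rule strong_maximum_principle[OF open_domain assms(1) smooth_p_function[OF open_domain smooth]
        coef(3) coef(4) continuous_coef second_order_p_function_bounds(1) assms(2-4)])



end

section \<open>Rigidity\<close>

text \<open>A binary cubic form with coefficients \<open>c0, c1, c2, c3\<close> that is apolar to two quadratic forms without common
  zero vanishes.  Here one of the quadratic forms is the square of a linear form and the other is definite, and \<open>D\<^sup>2\<close>
  is their resultant.\<close>

lemma apolar_cubic_zero:
  fixes c0 c1 c2 c3 p1 p2 h11 h12 h22 :: real
  assumes E1: "c2 * p1\<^sup>2 - 2 * c1 * (p1 * p2) + c0 * p2\<^sup>2 = 0" and E2: "c3 * p1\<^sup>2 - 2 * c2 * (p1 * p2) + c1 * p2\<^sup>2 = 0"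
    and F1: "h22 * c0 - 2 * h12 * c1 + h11 * c2 = 0" and F2: "h22 * c1 - 2 * h12 * c2 + h11 * c3 = 0"
    and h: "h11 * h22 - h12\<^sup>2 = 1" and p: "p1 \<noteq> 0 \<or> p2 \<noteq> 0"
  shows "c0 = 0 \<and> c1 = 0 \<and> c2 = 0 \<and> c3 = 0"
proof -
  have h11: "h11 \<noteq> 0"
  proof
    assume "h11 = 0"
    then show False using h zero_le_power2[of h12] by simp
  qed
  define D where "D = h22 * p1\<^sup>2 - 2 * h12 * p1 * p2 + h11 * p2\<^sup>2"
  have "h11 * D = (h11 * p2 - h12 * p1)\<^sup>2 + p1\<^sup>2"
    using h unfolding D_def by algebra
  then have D: "D \<noteq> 0" using p h11 by (auto simp: sum_power2_eq_zero_iff)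
  show ?thesis
  proof (cases "p1 = 0")
    case True
    then have "p2 \<noteq> 0" using p by simp
    then show ?thesis using True E1 E2 F1 F2 h11 by simp
  next
    case False
    \<comment> \<open>Eliminating \<open>c2\<close> and \<open>c3\<close> leaves two linear equations \<open>X\<close>, \<open>Y\<close> for \<open>c0\<close>, \<open>c1\<close> with determinant
      \<open>p1 D\<^sup>2\<close>.\<close>
    define \<alpha> where "\<alpha> = h22 * p1\<^sup>2 - h11 * p2\<^sup>2"
    define \<beta> where "\<beta> = h11 * p2 - h12 * p1"
    have X: "\<alpha> * c0 + 2 * p1 * \<beta> * c1 = 0"
      using E1 F1 unfolding \<alpha>_def \<beta>_def by algebra
    have Y: "- 2 * \<beta> * p2\<^sup>2 * c0 + (\<alpha> * p1 + 4 * \<beta> * p1 * p2) * c1 = 0"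
      using E1 E2 F2 unfolding \<alpha>_def \<beta>_def by algebra
    have Dab: "D = \<alpha> + 2 * \<beta> * p2" by (simp add: D_def \<alpha>_def \<beta>_def power2_eq_square algebra_simps)
    have "p1 * D\<^sup>2 * c0 = 0" using X Y unfolding Dab by algebra
    then have c0: "c0 = 0" using False D by simp
    then have c1: "c1 = 0" using X Y False D Dab by (cases "\<beta> = 0") auto
    then have c2: "c2 = 0" using E1 c0 False by simp
    then show ?thesis using E2 c0 c1 False by simp
  qed
qed

context monge_ampere
begin

text \<open>In the plane \<open>\<psi>\<close> is, up to the term \<open>-2u\<close>, the square of the gradient rotated by a right angle in the metric \<open>D\<^sup>2u\<close>.  Where the
  gradient does not vanish, constancy of \<open>\<psi>\<close> makes the form of third derivatives apolar to a square of a linear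
  form, and the differentiated equation makes it apolar to the Hessian.  The gradient cannot vanish on an open set.\<close>

lemma planar_third_derivatives_zero:
  assumes n: "CARD('n) = 2" and const: "\<And>x. x \<in> \<Omega> \<Longrightarrow> p_function u x = K" and x: "x \<in> \<Omega>"
  shows "partial i (partial j (partial k u)) x = 0"
proof (rule ccontr)
  assume ne: "partial i (partial j (partial k u)) x \<noteq> 0"
  obtain a b :: 'n where ab: "(UNIV :: 'n set) = {a, b}" "a \<noteq> b" using n by (metis card_2_iff)
  have sum2: "(\<Sum>m\<in>UNIV. f m) = f a + f b" for f :: "'n \<Rightarrow> real" unfolding ab(1) using ab(2) by simp
  have all2: "m = a \<or> m = b" for m using ab(1) by blast
  have vanish: "partial i (partial j (partial k u)) y = 0" if y: "y \<in> \<Omega>" and m: "partial m u y \<noteq> 0" for y m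
  proof -
    let ?h = "\<lambda>k l. partial k (partial l u)"
    note S = open_domain
    have com: "?h k l z = ?h l k z" if "z \<in> \<Omega>" for k l z by (rule partial_commute[OF S smooth that])
    have com3: "partial k (?h a b) y = partial a (?h b k) y" "partial k (?h b b) y = partial b (?h b k) y"
       "partial k (?h a a) y = partial a (?h a k) y" "partial b (?h a a) y = partial a (?h b a) y"
       "partial a (?h b a) y = partial a (?h a b) y" "partial b (?h b a) y = partial a (?h b b) y" for k
      using partial_commute3[OF S smooth y] by metis+
    have D: "((\<lambda>t. f (y + t *\<^sub>R axis k 1)) has_real_derivative partial k f y) (at 0)" if "smooth_on \<Omega> f" for f k
    proof -
      have "f differentiable (at (y + 0 *\<^sub>R axis k 1))" using smooth_differentiable[OF that y] by simp
      from line_derivative[OF this] show ?thesis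
        by (simp add: axis_def if_distrib if_distribR cong: if_cong)
    qed
    have sm: "smooth_on \<Omega> u" "\<And>k. smooth_on \<Omega> (partial k u)" "\<And>k l. smooth_on \<Omega> (?h k l)"
      by (intro smooth_intros smooth)+
    note D' = D[OF sm(1)] D[OF sm(2)] D[OF sm(3)]
    have det: "?h a a z * ?h b b z - ?h a b z * ?h a b z = 1" if "z \<in> \<Omega>" for z
      using det1[OF that] com[OF that, of a b] by (simp add: det_card_2[OF ab] hess_def)
    have dP: "?h b b z * (partial a u z * partial a u z) - 2 * (?h a b z * (partial a u z * partial b u z))
        + ?h a a z * (partial b u z * partial b u z) - 2 * u z = K" if "z \<in> \<Omega>" for z
      using const[OF that] com[OF that, of a b] ab(2)
      by (simp add: p_function_def newton_def sum2 n algebra_simps)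
    have F: "?h b b y * partial k (?h a a) y - 2 * ?h a b y * partial k (?h a b) y + ?h a a y * partial k (?h b b) y = 0" for k
    proof -
      have "partial k (\<lambda>z. ?h a a z * ?h b b z - ?h a b z * ?h a b z) y = 0"
        by (subst partial_cong[OF S y, of _ "\<lambda>_. 1"]) (simp_all add: det partial_const)
      moreover have "partial k (\<lambda>z. ?h a a z * ?h b b z - ?h a b z * ?h a b z) y =
          ?h a a y * partial k (?h b b) y + partial k (?h a a) y * ?h b b y - 2 * (?h a b y * partial k (?h a b) y)"
        unfolding partial_def[of k "\<lambda>z. ?h a a z * ?h b b z - ?h a b z * ?h a b z"]
        by (rule DERIV_imp_deriv) (auto intro!: derivative_eq_intros D')
      ultimately show ?thesis by (simp add: algebra_simps)
    qed
    have E: "partial k (?h b b) y * (partial a u y)\<^sup>2 - 2 * partial k (?h a b) y * (partial a u y * partial b u y)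
        + partial k (?h a a) y * (partial b u y)\<^sup>2 = 0" for k
    proof -
      let ?G = "\<lambda>z. ?h b b z * (partial a u z * partial a u z) - 2 * (?h a b z * (partial a u z * partial b u z))
        + ?h a a z * (partial b u z * partial b u z) - 2 * u z"
      have z: "partial k ?G y = 0"
        by (subst partial_cong[OF S y, of _ "\<lambda>_. K"]) (simp_all add: dP partial_const)
      have e: "partial k ?G y = partial k (?h b b) y * (partial a u y)\<^sup>2 - 2 * partial k (?h a b) y * (partial a u y * partial b u y)
        + partial k (?h a a) y * (partial b u y)\<^sup>2 + 2 * (?h b b y * partial a u y * ?h k a y)
        - 2 * ?h a b y * (?h k a y * partial b u y + partial a u y * ?h k b y)
        + 2 * (?h a a y * partial b u y * ?h k b y) - 2 * partial k u y"
        unfolding partial_def[of k ?G]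
        by (rule DERIV_imp_deriv) (auto intro!: derivative_eq_intros D' simp: power2_eq_square algebra_simps)
      \<comment> \<open>The terms with second derivatives only: the adjugate cancels the Hessian and
        leaves \<open>2 u\<^sub>k\<close>, the derivative of \<open>2 u\<close>.\<close>
      have "2 * (?h b b y * partial a u y * ?h k a y)
        - 2 * ?h a b y * (?h k a y * partial b u y + partial a u y * ?h k b y)
        + 2 * (?h a a y * partial b u y * ?h k b y) - 2 * partial k u y = 0"
      proof -
        have "2 * (h22 * p1 * h11) - 2 * h12 * (h11 * p2 + p1 * h12) + 2 * (h11 * p2 * h12) - 2 * p1 = 0"
          "2 * (h22 * p1 * h12) - 2 * h12 * (h12 * p2 + p1 * h22) + 2 * (h11 * p2 * h22) - 2 * p2 = 0"
          if "h11 * h22 - h12 * h12 = 1" for h11 h12 h22 p1 p2 :: real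
          using that by algebra+
        from this[OF det[OF y]] show ?thesis
          using all2[of k] com[OF y, of a b] by auto
      qed
      then show ?thesis using z e by linarith
    qed
    have "partial a (?h a a) y = 0 \<and> partial a (?h a b) y = 0 \<and> partial a (?h b b) y = 0 \<and> partial b (?h b b) y = 0"
    proof (rule apolar_cubic_zero)
      show "partial a (?h b b) y * (partial a u y)\<^sup>2 - 2 * partial a (?h a b) y * (partial a u y * partial b u y)
        + partial a (?h a a) y * (partial b u y)\<^sup>2 = 0" by (rule E)
      show "partial b (?h b b) y * (partial a u y)\<^sup>2 - 2 * partial a (?h b b) y * (partial a u y * partial b u y)
        + partial a (?h a b) y * (partial b u y)\<^sup>2 = 0" using E[of b] com3 by metis
      show "?h b b y * partial a (?h a a) y - 2 * ?h a b y * partial a (?h a b) y + ?h a a y * partial a (?h b b) y = 0"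
        by (rule F)
      show "?h b b y * partial a (?h a b) y - 2 * ?h a b y * partial a (?h b b) y + ?h a a y * partial b (?h b b) y = 0"
        using F[of b] com3 by metis
      show "?h a a y * ?h b b y - (?h a b y)\<^sup>2 = 1" using det[OF y] by (simp add: power2_eq_square)
      show "partial a u y \<noteq> 0 \<or> partial b u y \<noteq> 0" using m all2 by metis
    qed
    then show ?thesis using all2[of i] all2[of j] all2[of k] com3 by metis
  qed
  let ?U = "{y \<in> \<Omega>. partial i (partial j (partial k u)) y \<noteq> 0}"
  have "continuous_on \<Omega> (partial i (partial j (partial k u)))"
    by (intro smooth_continuous smooth_intros smooth)
  then have "open ?U"
    using continuous_open_preimage[OF _ open_domain, of "partial i (partial j (partial k u))" "- {0}"]
    by (simp add: vimage_def Int_def open_Compl)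
  moreover have xU: "x \<in> ?U" using x ne by simp
  moreover have "partial m u y = 0" if "y \<in> ?U" for y m using vanish that by blast
  ultimately have "partial l (partial m u) x = partial l (\<lambda>_. 0) x" for l m
    by (intro partial_cong) auto
  then have "hess u x $ a $ a = 0" by (simp add: hess_def partial_const)
  then show False using pos_def_diagonal[OF pos[OF x], of a] by simp
qed

lemma hessian_constant_if_p_function_constant:
  assumes n: "CARD('n) \<ge> 2" and conv: "convex \<Omega>" and const: "\<And>x. x \<in> \<Omega> \<Longrightarrow> p_function u x = K"
    and xy: "x \<in> \<Omega>" "y \<in> \<Omega>"
  shows "hess u x = hess u y" "CARD('n) \<ge> 3 \<Longrightarrow> hess u x = mat 1"
proof -
  have 3: "hess u x = mat 1" if x: "x \<in> \<Omega>" and n3: "CARD('n) \<ge> 3" for x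
  proof (rule second_order_p_function_bounds(2)[OF x _ n3])
    show "second_order (coef x) (p_function u) x = 0"
      by (subst second_order_cong[OF open_domain x const]) (simp_all add: second_order_const[OF open_domain])
  qed
  show "CARD('n) \<ge> 3 \<Longrightarrow> hess u x = mat 1" by (rule 3[OF xy(1)])
  show "hess u x = hess u y"
  proof (cases "CARD('n) \<ge> 3")
    case False
    then have n2: "CARD('n) = 2" using n by simp
    have "partial i (partial j u) x = partial i (partial j u) y" for i j
      by (rule constant_if_partials_zero[OF conv _ _ xy])
         (auto intro: smooth_partial smooth planar_third_derivatives_zero[OF n2 const])
    then show ?thesis by (simp add: hess_def)
  qed (simp add: 3 xy)
qed

text \<open>Two integrations: first the gradients, then the functions agree with those of a quadratic function that is
  matched at one point.  Its centre \<open>c\<close> is the critical point of the quadratic function and may lie anywhere.\<close>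

lemma quadratic_if_hessian_constant:
  assumes conv: "convex \<Omega>" and x0: "x0 \<in> \<Omega>" and const: "\<And>x. x \<in> \<Omega> \<Longrightarrow> hess u x = hess u x0"
  shows "\<exists>c s. \<forall>x\<in>\<Omega>. u x = quad (hess u x0) c s x"
proof -
  let ?A = "hess u x0"
  note symA = sym[OF x0]
  define c where "c = x0 - matrix_inv ?A *v (\<chi> k. partial k u x0)"
  define s where "s = quad ?A c 0 x0 - u x0"
  let ?q = "quad ?A c s"
  have smq: "smooth_on \<Omega> ?q" by (rule smooth_quad[OF open_domain])
  have g0: "partial k ?q x0 = partial k u x0" for k
    by (simp add: partial_quad[OF symA] c_def matrix_vector_mul_assoc coef(1)[OF x0])
  have grad_eq: "partial k u x - partial k ?q x = 0" if x: "x \<in> \<Omega>" for k x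
  proof -
    have "partial k u x - partial k ?q x = partial k u x0 - partial k ?q x0"
    proof (rule constant_if_partials_zero[OF conv _ _ x x0])
      show "smooth_on \<Omega> (\<lambda>x. partial k u x - partial k ?q x)"
        by (intro smooth_intros open_domain smooth smq)
      fix l y assume y: "y \<in> \<Omega>"
      have "partial l (\<lambda>x. partial k u x - partial k ?q x) y = partial l (partial k u) y - partial l (partial k ?q) y"
        by (intro partial_diff smooth_differentiable[OF _ y] smooth_partial smooth smq)
      also have "\<dots> = hess u y $ l $ k - ?A $ l $ k"
        unfolding second_partial_quad[OF symA] by (simp add: hess_def)
      finally show "partial l (\<lambda>x. partial k u x - partial k ?q x) y = 0" using const[OF y] by simp
    qed
    then show ?thesis using g0 by simp
  qed
  have "u x - ?q x = u x0 - ?q x0" if x: "x \<in> \<Omega>" for x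
  proof (rule constant_if_partials_zero[OF conv _ _ x x0])
    show "smooth_on \<Omega> (\<lambda>x. u x - ?q x)" by (intro smooth_intros open_domain smooth smq)
    fix l y assume y: "y \<in> \<Omega>"
    show "partial l (\<lambda>x. u x - ?q x) y = 0"
      using grad_eq[OF y, of l] by (subst partial_diff) (auto intro!: smooth_differentiable[OF _ y] smooth smq)
  qed
  moreover have "?q x0 = u x0" by (simp add: s_def quad_def)
  ultimately show ?thesis by (intro exI[of _ c] exI[of _ s]) force
qed

end

section \<open>Sublevel sets of quadratic functions\<close>

lemma quad_nonneg_form:
  assumes "pos_def A"
  shows "v \<bullet> (A *v v) \<ge> 0"
  using assms by (cases "v = 0") (auto simp: pos_def_def less_imp_le)

lemma quad_sublevel_center:
  assumes "pos_def A" "quad A c s x < 0"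
  shows "s > 0"
  using assms(2) quad_nonneg_form[OF assms(1), of "x - c"] by (simp add: quad_def)

text \<open>The sublevel set is star-shaped about the centre of the quadratic function.\<close>

lemma connected_quad_sublevel:
  fixes A :: "real^'n^'n"
  assumes pd: "pos_def A"
  shows "connected {x. quad A c s x < 0}"
proof (cases "{x. quad A c s x < 0} = {}")
  case False
  then have s: "s > 0" using quad_sublevel_center[OF pd] by blast
  have "starlike {x. quad A c s x < 0}"
    unfolding starlike_def
  proof (intro bexI ballI subsetI)
    show "c \<in> {x. quad A c s x < 0}" using s by (simp add: quad_def)
    fix x y assume x: "x \<in> {x. quad A c s x < 0}" and "y \<in> closed_segment c x"
    then obtain t where t: "0 \<le> t" "t \<le> 1" and y: "y = (1 - t) *\<^sub>R c + t *\<^sub>R x"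
      by (auto simp: closed_segment_def)
    have "y - c = t *\<^sub>R (x - c)" by (simp add: y algebra_simps)
    then have "quad A c s y = t\<^sup>2 * ((x - c) \<bullet> (A *v (x - c))) / 2 - s"
      by (simp add: quad_def matrix_vector_mult_scaleR power2_eq_square)
    also have "\<dots> \<le> quad A c s x"
      using mult_right_mono[OF power_le_one[OF t, of 2] quad_nonneg_form[OF pd, of "x - c"]]
      by (simp add: quad_def)
    finally show "y \<in> {x. quad A c s x < 0}" using x by simp
  qed
  then show ?thesis by (rule starlike_imp_connected)
qed simp

lemma frontier_quad_sublevel:
  assumes "z \<in> frontier {x. quad A c s x < 0}"
  shows "quad A c s z = 0"
proof -
  have o: "open {x. quad A c s x < 0}"
    by (intro open_Collect_less continuous_quad continuous_intros)
  have "closure {x. quad A c s x < 0} \<subseteq> {x. quad A c s x \<le> 0}"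
    by (rule closure_minimal) (auto intro!: closed_Collect_le continuous_quad continuous_intros)
  then show ?thesis
    using assms o by (auto simp: frontier_def interior_open)
qed

lemma quad_identity_sublevel:
  assumes "s > 0"
  shows "{x :: real^'n. quad (mat 1) c s x < 0} = ball c (sqrt (2 * s))"
proof -
  have "quad (mat 1) c s x < 0 \<longleftrightarrow> dist c x < sqrt (2 * s)" for x :: "real^'n"
  proof -
    have "quad (mat 1) c s x < 0 \<longleftrightarrow> (dist c x)\<^sup>2 < 2 * s"
      by (simp add: quad_def dist_norm norm_minus_commute[of c] power2_norm_eq_inner mult.commute[of s])
    also have "\<dots> \<longleftrightarrow> dist c x < sqrt (2 * s)"
      using real_less_rsqrt real_sqrt_less_iff[of "(dist c x)\<^sup>2" "2 * s"] by simp
    finally show ?thesis .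
  qed
  then show ?thesis by (auto simp: ball_def)
qed

lemma is_ellipse_quad_sublevel:
  fixes A :: "real^'n^'n"
  assumes n: "CARD('n) = 2" and sym: "transpose A = A" and pd: "pos_def A" and s: "s > 0"
  shows "is_ellipse {x. quad A c s x < 0}"
proof -
  obtain i j :: 'n where ij: "(UNIV :: 'n set) = {i, j}" "i \<noteq> j" using n by (metis card_2_iff)
  obtain e lam where es: "eigensystem A e lam" using spectral_theorem[OF sym] .
  note lam = eigenvalues_positive[OF es pd]
  define a where "a k = sqrt (2 * s / lam k)" for k
  have a: "a k > 0" "(a k)\<^sup>2 = 2 * s / lam k" for k using s lam[of k] by (simp_all add: a_def)
  have q: "quad A c s x < 0 \<longleftrightarrow> (((x - c) \<bullet> e i) / a i)\<^sup>2 + (((x - c) \<bullet> e j) / a j)\<^sup>2 < 1" for x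
  proof -
    have "(x - c) \<bullet> (A *v (x - c)) = lam i * ((x - c) \<bullet> e i)\<^sup>2 + lam j * ((x - c) \<bullet> e j)\<^sup>2"
      unfolding eigensystem_form[OF es] ij(1) using ij(2) by simp
    moreover have "lam k * y\<^sup>2 = 2 * s * (y / a k)\<^sup>2" for k y
      using s lam[of k] by (simp add: power_divide a(2))
    ultimately have "quad A c s x = s * ((((x - c) \<bullet> e i) / a i)\<^sup>2 + (((x - c) \<bullet> e j) / a j)\<^sup>2 - 1)"
      by (simp add: quad_def algebra_simps)
    then show ?thesis using s by (simp add: mult_less_0_iff)
  qed
  show ?thesis
    unfolding is_ellipse_def
  proof (intro conjI exI)
    show "norm (e i) = 1" "norm (e j) = 1" "e i \<bullet> e j = 0"
      using ij(2) by (simp_all add: norm_eq_sqrt_inner eigensystem_orthonormal[OF es])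
    show "a i > 0" "a j > 0" by (rule a)+
    show "{x. quad A c s x < 0} = {x. (((x - c) \<bullet> e i) / a i)\<^sup>2 + (((x - c) \<bullet> e j) / a j)\<^sup>2 < 1}"
      using q by blast
  qed (rule n)
qed

text \<open>The coefficients normalise the determinant: with semi-axes \<open>a, b\<close> the matrix has eigenvalues \<open>b / a\<close> and \<open>a / b\<close>.\<close>

lemma is_ellipse_imp_quad_sublevel:
  fixes E :: "(real^'n) set"
  assumes "is_ellipse E"
  shows "\<exists>(A :: real^'n^'n) c s. transpose A = A \<and> pos_def A \<and> det A = 1 \<and> E = {x. quad A c s x < 0}"
proof -
  obtain c e f a b where n: "CARD('n) = 2" and ef: "norm e = 1" "norm f = 1" "e \<bullet> f = 0" and ab: "a > 0" "b > 0"
    and E: "E = {x. (((x - c) \<bullet> e) / a)\<^sup>2 + (((x - c) \<bullet> f) / b)\<^sup>2 < 1}"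
    using assms unfolding is_ellipse_def by blast
  obtain i j :: 'n where ij: "(UNIV :: 'n set) = {i, j}" "i \<noteq> j" using n by (metis card_2_iff)
  have dot: "x \<bullet> y = x $ i * y $ i + x $ j * y $ j" for x y :: "real^'n"
    unfolding inner_vec_def ij(1) using ij(2) by simp
  have ee: "e $ i * e $ i + e $ j * e $ j = 1" "f $ i * f $ i + f $ j * f $ j = 1" "e $ i * f $ i + e $ j * f $ j = 0"
    using ef dot[of e e] dot[of f f] dot[of e f] by (simp_all add: norm_eq_1)
  define A :: "real^'n^'n" where "A = (\<chi> k l. (b / a) * (e $ k * e $ l) + (a / b) * (f $ k * f $ l))"
  have form: "v \<bullet> (A *v v) = (b / a) * (v \<bullet> e)\<^sup>2 + (a / b) * (v \<bullet> f)\<^sup>2" for v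
    unfolding quadratic_form_sum
    by (simp add: A_def distrib_left sum.distrib inner_vec_def power2_eq_square
        sum_product sum_distrib_left mult_ac)
  have cross: "(e $ i * f $ j - e $ j * f $ i)\<^sup>2 = 1"
    using ee by algebra
  have "pos_def A"
    unfolding pos_def_def
  proof (intro allI impI)
    fix v :: "real^'n" assume v: "v \<noteq> 0"
    have "\<not> (v \<bullet> e = 0 \<and> v \<bullet> f = 0)"
    proof
      assume h: "v \<bullet> e = 0 \<and> v \<bullet> f = 0"
      have "v $ i * (e $ i * f $ j - e $ j * f $ i) = f $ j * (v \<bullet> e) - e $ j * (v \<bullet> f)"
        "v $ j * (e $ i * f $ j - e $ j * f $ i) = e $ i * (v \<bullet> f) - f $ i * (v \<bullet> e)"
        by (simp_all add: dot algebra_simps)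
      then have "v $ i = 0 \<and> v $ j = 0" using h cross by auto
      moreover have "k = i \<or> k = j" for k using ij(1) by blast
      ultimately have "v = 0" by (auto simp: vec_eq_iff) metis
      then show False using v by simp
    qed
    then have "(b / a) * (v \<bullet> e)\<^sup>2 > 0 \<or> (a / b) * (v \<bullet> f)\<^sup>2 > 0" using ab by auto
    moreover have "(b / a) * (v \<bullet> e)\<^sup>2 \<ge> 0" "(a / b) * (v \<bullet> f)\<^sup>2 \<ge> 0" using ab by auto
    ultimately show "v \<bullet> (A *v v) > 0" unfolding form by linarith
  qed
  moreover have "transpose A = A" by (rule symmetricI) (simp add: A_def mult_ac)
  moreover have "det A = 1"
  proof -
    have "det A = (b / a) * (a / b) * (e $ i * f $ j - e $ j * f $ i)\<^sup>2"
      by (simp add: det_card_2[OF ij] A_def power2_eq_square algebra_simps)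
    then show ?thesis using cross ab by simp
  qed
  moreover have "quad A c (a * b / 2) x < 0 \<longleftrightarrow> (((x - c) \<bullet> e) / a)\<^sup>2 + (((x - c) \<bullet> f) / b)\<^sup>2 < 1" for x
  proof -
    have eq: "quad A c (a * b / 2) x = (a * b / 2) * ((((x - c) \<bullet> e) / a)\<^sup>2 + (((x - c) \<bullet> f) / b)\<^sup>2 - 1)"
      using ab by (simp add: quad_def form field_simps power2_eq_square)
    have pos_cancel: "k * y < 0 \<longleftrightarrow> y < 0" if "k > 0" for k y :: real
      using that by (simp add: mult_less_0_iff)
    have "a * b / 2 > 0" using ab by simp
    then show ?thesis unfolding eq by (subst pos_cancel) auto
  qed
  then have "E = {x. quad A c (a * b / 2) x < 0}" unfolding E by blast
  ultimately show ?thesis by blast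
qed

section \<open>The Dirichlet problem\<close>

locale dirichlet = monge_ampere +
  assumes nonempty: "\<Omega> \<noteq> {}" and bounded_domain: "bounded \<Omega>"
    and cont: "continuous_on (closure \<Omega>) u" and zero: "\<And>x. x \<in> frontier \<Omega> \<Longrightarrow> u x = 0"
begin

text \<open>The zero set of the quadratic function contains the boundary, and its sublevel set is connected.\<close>

lemma domain_if_quadratic:
  assumes A: "transpose A = A" "pos_def A" and u: "\<And>x. x \<in> \<Omega> \<Longrightarrow> u x = quad A c s x"
  shows "\<Omega> = {x. quad A c s x < 0}"
proof -
  let ?q = "quad A c s"
  have "u x - ?q x = 0" if "x \<in> closure \<Omega>" for x
    by (rule continuous_constant_on_closure[OF _ _ that])
       (auto intro!: continuous_intros cont continuous_quad simp: u)
  then have q0: "?q x = 0" if "x \<in> frontier \<Omega>" for x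
    using that zero[OF that] by (auto simp: frontier_def)
  have I: "transpose (mat 1 :: real^'a^'a) = mat 1" "pos_def (mat 1 :: real^'a^'a)"
    by (simp_all add: transpose_mat pos_def_def)
  have smq: "smooth_on \<Omega> ?q" by (rule smooth_quad[OF open_domain])
  have Lq: "second_order (mat 1) ?q x = trace A" for x by (simp add: second_order_quad[OF A(1)])
  have "\<exists>z\<in>frontier \<Omega>. \<forall>x\<in>closure \<Omega>. ?q x \<le> ?q z"
    by (rule weak_maximum_principle[OF open_domain nonempty bounded_domain continuous_quad smq I])
       (use pos_def_trace[OF A(2)] in \<open>simp add: Lq\<close>)
  then have le: "?q x \<le> 0" if "x \<in> \<Omega>" for x using q0 that closure_subset by fastforce
  have less: "?q x < 0" if x: "x \<in> \<Omega>" for x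
  proof (rule ccontr)
    assume "\<not> ?q x < 0"
    then have "?q y \<le> ?q x" if "y \<in> \<Omega>" for y using le[OF x] le[OF that] by linarith
    then have "second_order (mat 1) ?q x \<le> 0"
      by (rule second_order_at_max[OF open_domain smq x _ I])
    then show False using pos_def_trace[OF A(2)] by (simp add: Lq)
  qed
  have "{x. ?q x < 0} \<subseteq> \<Omega>"
  proof (rule ccontr)
    assume "\<not> {x. ?q x < 0} \<subseteq> \<Omega>"
    then have "{x. ?q x < 0} \<inter> frontier \<Omega> \<noteq> {}"
      using nonempty less by (intro connected_Int_frontier connected_quad_sublevel A(2)) auto
    then show False using q0 by fastforce
  qed
  then show ?thesis using less by blast
qed

text \<open>Uniqueness by comparison: by the inequality between arithmetic and geometric means both differences are
  subsolutions, of the equations linearised at the quadratic function and at \<open>u\<close>, respectively.\<close>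

lemma quadratic_if_domain:
  assumes A: "transpose A = A" "pos_def A" "det A = 1" and dom: "\<Omega> = {x. quad A c s x < 0}" and x: "x \<in> \<Omega>"
  shows "u x = quad A c s x"
proof -
  let ?q = "quad A c s"
  have q0: "?q z = 0" if "z \<in> frontier \<Omega>" for z
    using frontier_quad_sublevel that dom by metis
  have smq: "smooth_on \<Omega> ?q" by (rule smooth_quad[OF open_domain])
  have xc: "x \<in> closure \<Omega>" using x closure_subset by blast
  note inv = pos_def_inverse[OF A]
  have "\<exists>z\<in>frontier \<Omega>. \<forall>x\<in>closure \<Omega>. u x - ?q x \<le> u z - ?q z"
  proof (rule weak_maximum_principle[OF open_domain nonempty bounded_domain, where a = "\<lambda>_. matrix_inv A"])
    show "continuous_on (closure \<Omega>) (\<lambda>x. u x - ?q x)" by (intro continuous_intros cont continuous_quad)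
    show "smooth_on \<Omega> (\<lambda>x. u x - ?q x)" by (intro smooth_intros open_domain smooth smq)
    fix y assume y: "y \<in> \<Omega>"
    show "second_order (matrix_inv A) (\<lambda>x. u x - ?q x) y \<ge> 0"
      using trace_mult_ge_card[OF inv(3-5) sym[OF y] pos[OF y] det1[OF y]]
      by (simp add: second_order_diff[OF open_domain smooth smq y] second_order_quad[OF A(1)]
          second_order_hess[OF open_domain smooth y] inv(2) trace_I)
  qed (rule inv)+
  then have "u x - ?q x \<le> 0" using xc q0 zero by fastforce
  moreover have "\<exists>z\<in>frontier \<Omega>. \<forall>x\<in>closure \<Omega>. ?q x - u x \<le> ?q z - u z"
  proof (rule weak_maximum_principle[OF open_domain nonempty bounded_domain, where a = coef])
    show "continuous_on (closure \<Omega>) (\<lambda>x. ?q x - u x)" by (intro continuous_intros cont continuous_quad)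
    show "smooth_on \<Omega> (\<lambda>x. ?q x - u x)" by (intro smooth_intros open_domain smooth smq)
    fix y assume y: "y \<in> \<Omega>"
    show "second_order (coef y) (\<lambda>x. ?q x - u x) y \<ge> 0"
      using trace_mult_ge_card[OF coef(3-5)[OF y] A]
      by (simp add: second_order_diff[OF open_domain smq smooth y] second_order_quad[OF A(1)]
          second_order_solution[OF y])
  qed (rule coef, assumption)+
  then have "?q x - u x \<le> 0" using xc q0 zero by fastforce
  ultimately show ?thesis by linarith
qed

end

text \<open>The condition on \<open>A\<close> says that its Newton transformation is \<open>n - 1\<close> times its inverse; then the gradient term
  of \<open>\<psi>\<close> is \<open>n - 1\<close> times the quadratic form itself and cancels against \<open>2 (n - 1) u\<close>.\<close>

lemma p_function_quad:
  fixes A :: "real^'n^'n"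
  assumes S: "open S" "x \<in> S" and sym: "transpose A = A"
    and cof: "\<And>v. trace A *\<^sub>R (A *v v) - A *v (A *v v) = (real CARD('n) - 1) *\<^sub>R v"
    and u: "\<And>x. x \<in> S \<Longrightarrow> u x = quad A c s x"
  shows "p_function u x = 2 * (real CARD('n) - 1) * s"
proof -
  have pu: "partial k u y = (A *v (y - c)) $ k" if "y \<in> S" for k y
    using partial_cong[OF S(1) that u] by (simp add: partial_quad[OF sym])
  have ppu: "partial l (partial k u) x = A $ l $ k" for k l
  proof -
    have "partial l (partial k u) x = partial l (partial k (quad A c s)) x"
      by (rule partial_cong[OF S]) (simp add: pu partial_quad[OF sym])
    then show ?thesis by (simp add: second_partial_quad[OF sym])
  qed
  define p where "p = A *v (x - c)"
  have "(\<Sum>k\<in>UNIV. \<Sum>l\<in>UNIV. newton u k l x * (partial k u x * partial l u x))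
      = p \<bullet> (trace A *\<^sub>R p - A *v p)"
  proof -
    have "newton u k l x * (partial k u x * partial l u x)
        = (if k = l then trace A * (p $ k * p $ l) else 0) - p $ k * p $ l * A $ k $ l" for k l
      using symmetricD[OF sym, of k l] by (auto simp: newton_def ppu pu[OF S(2)] p_def trace_def algebra_simps)
    moreover have "p \<bullet> (trace A *\<^sub>R p - A *v p) = trace A * (p \<bullet> p) - (\<Sum>k\<in>UNIV. \<Sum>l\<in>UNIV. p $ k * p $ l * A $ k $ l)"
      by (simp only: inner_diff_right inner_scaleR_right quadratic_form_sum)
    ultimately show ?thesis
      by (simp add: sum_subtractf inner_vec_def sum_distrib_left)
  qed
  also have "\<dots> = (real CARD('n) - 1) * ((x - c) \<bullet> (A *v (x - c)))"
    unfolding p_def cof by (simp add: inner_commute)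
  finally show ?thesis by (simp add: p_function_def u[OF S(2)] quad_def algebra_simps)
qed

text \<open>In dimension two this is the Cayley-Hamilton theorem at determinant one.\<close>

lemma cofactor_identity_card_2:
  fixes A :: "real^'n^'n"
  assumes n: "CARD('n) = 2" and sym: "transpose A = A" and d: "det A = 1"
  shows "trace A *\<^sub>R (A *v v) - A *v (A *v v) = (real CARD('n) - 1) *\<^sub>R v"
proof -
  obtain i j :: 'n where ij: "(UNIV :: 'n set) = {i, j}" "i \<noteq> j" using n by (metis card_2_iff)
  have sum2: "(\<Sum>m\<in>UNIV. f m) = f i + f j" for f :: "'n \<Rightarrow> real" unfolding ij(1) using ij(2) by simp
  have det: "A $ i $ i * A $ j $ j - A $ i $ j * A $ i $ j = 1"
    using d symmetricD[OF sym, of i j] by (simp add: det_card_2[OF ij])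
  have alg: "(a + b) * (a * v + c * w) - (a * (a * v + c * w) + c * (c * v + b * w)) = v"
    "(a + b) * (c * v + b * w) - (c * (a * v + c * w) + b * (c * v + b * w)) = w"
    if "a * b - c * c = 1" for a b c v w :: real
    using that by algebra+
  have "(trace A *\<^sub>R (A *v v) - A *v (A *v v)) $ k = v $ k" for k
  proof -
    have "k = i \<or> k = j" using ij(1) by blast
    then show ?thesis
      using alg[OF det, of "v $ i" "v $ j"] symmetricD[OF sym, of i j]
      by (auto simp: trace_def matrix_vector_mult_def sum2)
  qed
  then show ?thesis by (simp add: vec_eq_iff n)
qed

theorem theorem1p2:
  fixes \<Omega> :: "(real^'n) set" and u :: "real^'n \<Rightarrow> real"
  assumes "CARD('n) \<ge> 2"
    and "open \<Omega>" "\<Omega> \<noteq> {}" "bounded \<Omega>" "convex \<Omega>"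
    and "strictly_convex_solution \<Omega> u"
  shows "(\<exists>x\<in>frontier \<Omega>. \<forall>y\<in>closure \<Omega>. psi \<Omega> u y \<le> psi \<Omega> u x) \<and>
    (CARD('n) = 2 \<longrightarrow>
       ((\<exists>x\<in>\<Omega>. \<forall>y\<in>closure \<Omega>. psi \<Omega> u y \<le> psi \<Omega> u x) \<longleftrightarrow> is_ellipse \<Omega>)) \<and>
    (CARD('n) \<ge> 3 \<longrightarrow>
       ((\<exists>x\<in>\<Omega>. \<forall>y\<in>closure \<Omega>. psi \<Omega> u y \<le> psi \<Omega> u x) \<longleftrightarrow> (\<exists>c r. 0 < r \<and> \<Omega> = ball c r)))"
proof -
  have sol: "smooth_on \<Omega> u" "C2_on_closure \<Omega> u" "\<And>x. x \<in> \<Omega> \<Longrightarrow> pos_def (hess u x)"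
    "\<And>x. x \<in> \<Omega> \<Longrightarrow> det (hess u x) = 1" "\<And>x. x \<in> frontier \<Omega> \<Longrightarrow> u x = 0"
    using assms(6) by (auto simp: strictly_convex_solution_def hessian_interior)
  have "continuous_on (closure \<Omega>) u" using sol(2) by (simp add: C2_on_closure_def)
  then interpret dirichlet \<Omega> u
    using assms sol by unfold_locales auto
  have cont_psi: "continuous_on (closure \<Omega>) (psi \<Omega> u)" by (rule continuous_psi[OF sol(2)])
  have smP: "smooth_on \<Omega> (p_function u)" by (rule smooth_p_function[OF open_domain smooth])
  have sm_psi: "smooth_on \<Omega> (psi \<Omega> u)"
    by (rule smooth_cong[OF open_domain _ smP]) (simp add: psi_interior)
  have L_psi: "second_order (coef x) (psi \<Omega> u) x \<ge> 0" if x: "x \<in> \<Omega>" for x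
  proof -
    have "second_order (coef x) (psi \<Omega> u) x = second_order (coef x) (p_function u) x"
      by (rule second_order_cong[OF open_domain x]) (rule psi_interior)
    then show ?thesis using second_order_p_function_bounds(1)[OF x] by simp
  qed
  have "\<exists>x\<in>frontier \<Omega>. \<forall>y\<in>closure \<Omega>. psi \<Omega> u y \<le> psi \<Omega> u x"
    by (rule weak_maximum_principle[OF assms(2-4) cont_psi sm_psi coef(3) coef(4) L_psi])
  moreover have rigid: "\<exists>A c s. transpose A = A \<and> pos_def A \<and> s > 0 \<and> \<Omega> = {x. quad A c s x < 0} \<and> (CARD('n) \<ge> 3 \<longrightarrow> A = mat 1)"
    if m: "\<exists>x\<in>\<Omega>. \<forall>y\<in>closure \<Omega>. psi \<Omega> u y \<le> psi \<Omega> u x"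
  proof -
    obtain x0 where x0: "x0 \<in> \<Omega>" "\<And>y. y \<in> closure \<Omega> \<Longrightarrow> psi \<Omega> u y \<le> psi \<Omega> u x0" using m by blast
    have "p_function u y \<le> p_function u x0" if "y \<in> \<Omega>" for y
      using x0(2)[of y] that closure_subset psi_interior x0(1) by (metis subsetD)
    then have const: "p_function u x = p_function u x0" if "x \<in> \<Omega>" for x
      using p_function_constant_if_interior_max[OF convex_connected[OF assms(5)] x0(1) _ that] by blast
    let ?A = "hess u x0"
    obtain c s where u: "\<And>x. x \<in> \<Omega> \<Longrightarrow> u x = quad ?A c s x"
      using quadratic_if_hessian_constant[OF assms(5) x0(1)]
        hessian_constant_if_p_function_constant(1)[OF assms(1,5) const _ x0(1)] by blast
    have dom: "\<Omega> = {x. quad ?A c s x < 0}"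
      by (rule domain_if_quadratic[OF sym[OF x0(1)] pos[OF x0(1)] u])
    then have "s > 0" using quad_sublevel_center[OF pos[OF x0(1)]] x0(1) by blast
    then show ?thesis
      using dom sym[OF x0(1)] pos[OF x0(1)]
        hessian_constant_if_p_function_constant(2)[OF assms(1,5) const x0(1) x0(1)] by blast
  qed
  moreover have attained: "\<exists>x\<in>\<Omega>. \<forall>y\<in>closure \<Omega>. psi \<Omega> u y \<le> psi \<Omega> u x"
    if A: "transpose A = A" "pos_def A" "det A = 1" and dom: "\<Omega> = {x. quad A c s x < 0}"
      and cof: "\<And>v. trace A *\<^sub>R (A *v v) - A *v (A *v v) = (real CARD('n) - 1) *\<^sub>R v" for A :: "real^'n^'n" and c s
  proof -
    have u: "u x = quad A c s x" if "x \<in> \<Omega>" for x by (rule quadratic_if_domain[OF A dom that])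
    have "psi \<Omega> u x = 2 * (real CARD('n) - 1) * s" if "x \<in> \<Omega>" for x
      using p_function_quad[OF open_domain that A(1) cof u] psi_interior[OF that] by simp
    then have const: "psi \<Omega> u x = 2 * (real CARD('n) - 1) * s" if "x \<in> closure \<Omega>" for x
      using continuous_constant_on_closure[OF cont_psi _ that] by blast
    obtain x where x: "x \<in> \<Omega>" using assms(3) by blast
    then have "x \<in> closure \<Omega>" using closure_subset by blast
    then show ?thesis using x const by (intro bexI[of _ x]) auto
  qed
  moreover have "is_ellipse \<Omega>" if "CARD('n) = 2" "\<exists>x\<in>\<Omega>. \<forall>y\<in>closure \<Omega>. psi \<Omega> u y \<le> psi \<Omega> u x"
    using rigid[OF that(2)] is_ellipse_quad_sublevel[OF that(1)] by blast
  moreover have "\<exists>x\<in>\<Omega>. \<forall>y\<in>closure \<Omega>. psi \<Omega> u y \<le> psi \<Omega> u x" if "CARD('n) = 2" "is_ellipse \<Omega>"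
    using is_ellipse_imp_quad_sublevel[OF that(2)] attained cofactor_identity_card_2[OF that(1)] by blast
  moreover have "\<exists>c r. 0 < r \<and> \<Omega> = ball c r" if n3: "CARD('n) \<ge> 3" and m: "\<exists>x\<in>\<Omega>. \<forall>y\<in>closure \<Omega>. psi \<Omega> u y \<le> psi \<Omega> u x"
  proof -
    obtain c s where s: "s > 0" and "\<Omega> = {x. quad (mat 1) c s x < 0}"
      using rigid[OF m] n3 by blast
    then have "\<Omega> = ball c (sqrt (2 * s))" by (simp add: quad_identity_sublevel)
    then show ?thesis using s by (intro exI[of _ c] exI[of _ "sqrt (2 * s)"]) simp
  qed
  moreover have "\<exists>x\<in>\<Omega>. \<forall>y\<in>closure \<Omega>. psi \<Omega> u y \<le> psi \<Omega> u x" if ball: "\<exists>c r. 0 < r \<and> \<Omega> = ball c r"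
  proof -
    obtain c r where r: "0 < r" "\<Omega> = ball c r" using ball by blast
    show ?thesis
    proof (rule attained)
      show "transpose (mat 1 :: real^'n^'n) = mat 1" "pos_def (mat 1 :: real^'n^'n)" "det (mat 1 :: real^'n^'n) = 1"
        by (simp_all add: transpose_mat pos_def_def)
      show "\<Omega> = {x. quad (mat 1) c (r\<^sup>2 / 2) x < 0}"
        using r by (simp add: quad_identity_sublevel)
      show "trace (mat 1 :: real^'n^'n) *\<^sub>R (mat 1 *v v) - mat 1 *v (mat 1 *v v) = (real CARD('n) - 1) *\<^sub>R v" for v :: "real^'n"
        by (simp add: trace_I scaleR_left_diff_distrib)
    qed
  qed
  ultimately show ?thesis by blast
qed

end
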